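(* Let the matrices $A_{II}^{(i)},A_{I\Gamma}^{(i)},A_{\Gamma I}^{(i)},A_{\Gamma\Gamma}^{(i)}$, $I_{\Gamma\Gamma}^{(i)}$ ($i\in\{1,\dots,p\}$), $M_{\Gamma\Gamma}$, and the block matrix $A$ be as described in the context. Assume that $$\sum_{i=1}^{p}\left|I_{\Gamma\Gamma}^{(i)}-M_{\Gamma\Gamma}^{-1}A_{\Gamma\Gamma}^{(i)}\right|=\left|\sum_{i=1}^{p}\left(I_{\Gamma\Gamma}^{(i)}-M_{\Gamma\Gamma}^{-1}A_{\Gamma\Gamma}^{(i)}\right)\right|.$$ If $A$ is an $\mathsf H$-matrix and $$\langle M_{\Gamma\Gamma}\rangle-|M_{\Gamma\Gamma}-A_{\Gamma\Gamma}|=\langle A_{\Gamma\Gamma}\rangle,$$ then the asynchronous primal Schur method is convergent.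
   Context: Matrices and vectors have entries in $\mathbb{K}=\mathbb{R}$ or $\mathbb{C}$. $\rho(\cdot)$ is the spectral radius, $|\mathcal A|$ is the entry-wise absolute value of a matrix or vector $\mathcal A$, $I$ is the identity matrix, and inequalities between matrices are entry-wise. An $\mathsf M$-matrix is a square matrix $\mathcal A$ for which there is a real $\alpha$ with $\alpha I-\mathcal A\ge 0$ and $\alpha>\rho(\alpha I-\mathcal A)$. The comparison matrix $\langle\mathcal A\rangle$ of a square matrix $\mathcal A=(a_{i,j})$ has diagonal entries $|a_{i,i}|$ and off-diagonal entries $-|a_{i,j}|$ ($i\neq j$). An $\mathsf H$-matrix is a matrix $\mathcal A$ such that $\langle\mathcal A\rangle$ is an $\mathsf M$-matrix. Setting (primal Schur domain decomposition with $p$ subdomains and interface $\Gamma$). For each $i\in\{1,\dots,p\}$ one is given matrices $A_{II}^{(i)}$ (square, nonsingular), $A_{I\Gamma}^{(i)}$, $A_{\Gamma I}^{(i)}$, $A_{\Gamma\Gamma}^{(i)}$ and vectors $b_I^{(i)}$, $b_\Gamma^{(i)}$ of compatible sizes; the size of the $I$-blocks may depend on $i$, and the index $\Gamma$ refers to one common finite index set. (When subdomain $i$ touches only a part $\Gamma_l$ of $\Gamma$, these blocks are obtained from local blocks through a Boolean restriction matrix $R^{(i)}_{\Gamma_l\Gamma}$ from $\Gamma$ to $\Gamma_l$, e.g. $A_{\Gamma\Gamma}^{(i)}={R^{(i)}_{\Gamma_l\Gamma}}^{\mathsf T}A^{(i)}_{\Gamma_l\Gamma_l}R^{(i)}_{\Gamma_l\Gamma}$.)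 Define $$S_{\Gamma\Gamma}^{(i)}:=A_{\Gamma\Gamma}^{(i)}-A_{\Gamma I}^{(i)}{A_{II}^{(i)}}^{-1}A_{I\Gamma}^{(i)},\quad d_\Gamma^{(i)}:=b_\Gamma^{(i)}-A_{\Gamma I}^{(i)}{A_{II}^{(i)}}^{-1}b_I^{(i)},\quad S_{\Gamma\Gamma}:=\sum_{i=1}^pS_{\Gamma\Gamma}^{(i)},\quad d_\Gamma:=\sum_{i=1}^pd_\Gamma^{(i)}.$$ The interface problem is $S_{\Gamma\Gamma}x_\Gamma=d_\Gamma$. Let $I_{\Gamma\Gamma}$ be the identity matrix on $\Gamma$, let $M_{\Gamma\Gamma}$ be a nonsingular matrix on $\Gamma$, and let $I_{\Gamma\Gamma}^{(1)},\dots,I_{\Gamma\Gamma}^{(p)}$ be matrices on $\Gamma$ with $\sum_{i=1}^pI_{\Gamma\Gamma}^{(i)}=I_{\Gamma\Gamma}$. Block matrix: $$A:=\begin{bmatrix}A_{II}^{(1)}&&0&A_{I\Gamma}^{(1)}\\ &\ddots&&\vdots\\ 0&&A_{II}^{(p)}&A_{I\Gamma}^{(p)}\\ A_{\Gamma I}^{(1)}&\cdots&A_{\Gamma I}^{(p)}&A_{\Gamma\Gamma}\end{bmatrix},\qquad A_{\Gamma\Gamma}:=\sum_{i=1}^pA_{\Gamma\Gamma}^{(i)}.$$ Asynchronous primal Schur method. Given initial vectors $x_\Gamma^{(i),0}$ ($i\in\{1,\dots,p\}$), sets $P^{(k)}\subseteq\{1,\dots,p\}$ ($k\in\mathbb{N}$)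 and maps $\tau_j^i:\mathbb{N}\to\mathbb{N}$ ($i,j\in\{1,\dots,p\}$) with $\tau_j^i(k)\le k$, such that (a) for every $i$, the set $\{k\in\mathbb{N}: i\in P^{(k)}\}$ is infinite, and (b) for all $i,j$, $\lim_{k\to\infty}\tau_j^i(k)=+\infty$, the method generates, for $k\in\mathbb{N}$ and $i\in\{1,\dots,p\}$, $$y_\Gamma^{(i),k}:=I_{\Gamma\Gamma}^{(i)}x_\Gamma^{(i),k}+M_{\Gamma\Gamma}^{-1}\left(d_\Gamma^{(i)}-S_{\Gamma\Gamma}^{(i)}x_\Gamma^{(i),k}\right),\qquad x_\Gamma^{(i),k+1}=\begin{cases}\sum_{j=1}^py_\Gamma^{(j),\tau_j^i(k)},& i\in P^{(k)},\\ x_\Gamma^{(i),k},& i\notin P^{(k)}.\end{cases}$$ The method is called convergent if, for all choices of the initial vectors $x_\Gamma^{(i),0}$, of sets $P^{(k)}\subseteq\{1,\dots,p\}$ such that $\{k\in\mathbb{N}: i\in P^{(k)}\}$ is infinite for every $i$, and of maps $\tau_j^i:\mathbb{N}\to\mathbb{N}$ such that $\tau_j^i(k)\le k$ for all $k$ and $\lim_{k\to\infty}\tau_j^i(k)=+\infty$ for all $i,j$, each sequence $(x_\Gamma^{(i),k})_{k}$, $i\in\{1,\dots,p\}$, converges as $k\to\infty$ to the solution $x_\Gamma$ of $S_{\Gamma\Gamma}x_\Gamma=d_\Gamma$. *)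

theory Defs
  imports "Jordan_Normal_Form.Spectral_Radius"
begin

text \<open>
  Scalars range over \<^class>\<open>real_normed_field\<close>: its norm is multiplicative, so by the
  Gelfand--Mazur theorem every instance is isometrically isomorphic to the reals or the complex
  numbers, and both of these are instances.

  The library has no topology on dynamically sized vectors; convergence is componentwise.
\<close>

definition mat_abs :: "'a :: real_normed_field mat \<Rightarrow> real mat" where
  "mat_abs A = map_mat norm A"

text \<open>Meaningful for invertible matrices only, where \<^const>\<open>mat_inverse\<close> is not \<^const>\<open>None\<close>.\<close>

definition mat_inv :: "'a :: field mat \<Rightarrow> 'a mat" where
  "mat_inv A = the (mat_inverse A)"

definition mat_sum :: "nat \<Rightarrow> nat \<Rightarrow> (nat \<Rightarrow> 'a :: comm_monoid_add mat) \<Rightarrow> 'a mat" where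
  "mat_sum p n F = mat n n (\<lambda>rc. \<Sum>i\<in>{1..p}. F i $$ rc)"

definition vec_sum :: "nat \<Rightarrow> nat \<Rightarrow> (nat \<Rightarrow> 'a :: comm_monoid_add vec) \<Rightarrow> 'a vec" where
  "vec_sum p n f = vec n (\<lambda>r. \<Sum>i\<in>{1..p}. f i $ r)"

text \<open>For the matrix with no rows the spectrum is empty and \<^const>\<open>spectral_radius\<close> is
  unspecified.\<close>

definition M_matrix :: "real mat \<Rightarrow> bool" where
  "M_matrix A \<longleftrightarrow> square_mat A \<and>
     (\<exists>\<alpha> :: real.
        0\<^sub>m (dim_row A) (dim_row A) \<le> \<alpha> \<cdot>\<^sub>m 1\<^sub>m (dim_row A) - A \<and>
        \<alpha> > spectral_radius (map_mat complex_of_real (\<alpha> \<cdot>\<^sub>m 1\<^sub>m (dim_row A) - A)))"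

definition comparison_mat :: "'a :: real_normed_field mat \<Rightarrow> real mat" where
  "comparison_mat A = mat (dim_row A) (dim_col A)
     (\<lambda>(r, c). if r = c then norm (A $$ (r, c)) else - norm (A $$ (r, c)))"

definition H_matrix :: "'a :: real_normed_field mat \<Rightarrow> bool" where
  "H_matrix A \<longleftrightarrow> M_matrix (comparison_mat A)"

definition schur_mat :: "'a :: field mat \<Rightarrow> 'a mat \<Rightarrow> 'a mat \<Rightarrow> 'a mat \<Rightarrow> 'a mat" where
  "schur_mat AII AIG AGI AGG = AGG - AGI * mat_inv AII * AIG"

definition schur_rhs :: "'a :: field mat \<Rightarrow> 'a mat \<Rightarrow> 'a vec \<Rightarrow> 'a vec \<Rightarrow> 'a vec" where
  "schur_rhs AII AGI bI bG = bG - (AGI * mat_inv AII) *\<^sub>v bI"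

text \<open>\<open>A\<^sub>1\<close>, ..., \<open>A\<^sub>p\<close> (each with \<open>n\<close> columns, resp. rows) below each other, resp. side by side.\<close>

definition stack_rows :: "nat \<Rightarrow> nat \<Rightarrow> (nat \<Rightarrow> 'a :: zero mat) \<Rightarrow> 'a mat" where
  "stack_rows p n F = foldr (@\<^sub>r) (map F [1..<Suc p]) (0\<^sub>m 0 n)"

definition stack_cols :: "nat \<Rightarrow> nat \<Rightarrow> (nat \<Rightarrow> 'a :: zero mat) \<Rightarrow> 'a mat" where
  "stack_cols p n F = transpose_mat (stack_rows p n (\<lambda>i. transpose_mat (F i)))"

definition schur_block_mat ::
  "nat \<Rightarrow> nat \<Rightarrow> (nat \<Rightarrow> 'a :: comm_monoid_add mat) \<Rightarrow> (nat \<Rightarrow> 'a mat) \<Rightarrow> (nat \<Rightarrow> 'a mat) \<Rightarrow> (nat \<Rightarrow> 'a mat) \<Rightarrow> 'a mat"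
  where
  "schur_block_mat p n AII AIG AGI AGG =
     four_block_mat
       (diag_block_mat (map AII [1..<Suc p])) (stack_rows p n AIG)
       (stack_cols p n AGI)                   (mat_sum p n AGG)"

text \<open>\<open>S i\<close> and \<open>d i\<close> are the local Schur complements and right-hand sides, \<open>J i\<close> the splitting of
  the identity, and \<open>\<tau> i j k\<close> stands for \<open>\<tau>\<^sub>j\<^sup>i(k)\<close>, the iteration index of the data of
  subdomain \<open>j\<close> used by subdomain \<open>i\<close>.\<close>

definition schur_local_update ::
  "'a :: field mat \<Rightarrow> (nat \<Rightarrow> 'a mat) \<Rightarrow> (nat \<Rightarrow> 'a mat) \<Rightarrow> (nat \<Rightarrow> 'a vec) \<Rightarrow> nat \<Rightarrow> 'a vec \<Rightarrow> 'a vec" where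
  "schur_local_update M J S d i v = J i *\<^sub>v v + mat_inv M *\<^sub>v (d i - S i *\<^sub>v v)"

definition async_schedule ::
  "nat \<Rightarrow> (nat \<Rightarrow> nat set) \<Rightarrow> (nat \<Rightarrow> nat \<Rightarrow> nat \<Rightarrow> nat) \<Rightarrow> bool" where
  "async_schedule p P \<tau> \<longleftrightarrow>
     (\<forall>k. P k \<subseteq> {1..p}) \<and>
     (\<forall>i\<in>{1..p}. infinite {k. i \<in> P k}) \<and>
     (\<forall>i\<in>{1..p}. \<forall>j\<in>{1..p}. (\<forall>k. \<tau> i j k \<le> k) \<and> filterlim (\<tau> i j) at_top sequentially)"

text \<open>The predicate below says that \<open>x\<close>, where \<open>x i k\<close> is the \<open>k\<close>-th iterate of subdomain \<open>i\<close>,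
  is generated by the method; since \<open>\<tau> i j k \<le> k\<close>, the iterates are determined by the initial
  vectors \<open>x i 0\<close>.\<close>

definition async_schur_iterates ::
  "nat \<Rightarrow> nat \<Rightarrow> 'a :: field mat \<Rightarrow> (nat \<Rightarrow> 'a mat) \<Rightarrow> (nat \<Rightarrow> 'a mat) \<Rightarrow> (nat \<Rightarrow> 'a vec) \<Rightarrow>
   (nat \<Rightarrow> nat set) \<Rightarrow> (nat \<Rightarrow> nat \<Rightarrow> nat \<Rightarrow> nat) \<Rightarrow> (nat \<Rightarrow> nat \<Rightarrow> 'a vec) \<Rightarrow> bool" where
  "async_schur_iterates p n M J S d P \<tau> x \<longleftrightarrow>
     (\<forall>i\<in>{1..p}. x i 0 \<in> carrier_vec n) \<and>
     (\<forall>k. \<forall>i\<in>{1..p}.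
        x i (Suc k) =
          (if i \<in> P k
           then vec_sum p n (\<lambda>j. schur_local_update M J S d j (x j (\<tau> i j k)))
           else x i k))"

definition async_schur_convergent ::
  "nat \<Rightarrow> nat \<Rightarrow> 'a :: real_normed_field mat \<Rightarrow> (nat \<Rightarrow> 'a mat) \<Rightarrow> (nat \<Rightarrow> 'a mat) \<Rightarrow> (nat \<Rightarrow> 'a vec) \<Rightarrow> bool"
  where
  "async_schur_convergent p n M J S d \<longleftrightarrow>
     (\<exists>xs \<in> carrier_vec n.
        mat_sum p n S *\<^sub>v xs = vec_sum p n d \<and>
        (\<forall>z \<in> carrier_vec n. mat_sum p n S *\<^sub>v z = vec_sum p n d \<longrightarrow> z = xs) \<and>
        (\<forall>P \<tau> x. async_schedule p P \<tau> \<longrightarrow> async_schur_iterates p n M J S d P \<tau> x \<longrightarrow>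
           (\<forall>i\<in>{1..p}. \<forall>r<n. (\<lambda>k. x i k $ r) \<longlonglongrightarrow> xs $ r)))"

end

theory Submission
  imports Defs
begin

text \<open>
  Write \<open>T\<^sub>j = J\<^sub>j - M\<^sup>-\<^sup>1 S\<^sub>j\<close>. Subtracting the solution, every update of the method replaces an error by
  \<open>\<Sum>\<^sub>j T\<^sub>j e\<^sub>j\<close>, where the \<open>e\<^sub>j\<close> are errors of possibly outdated iterates. Convergence under arbitrary delays
  follows if some positive weight \<open>v\<close> on the interface satisfies \<open>\<Sum>\<^sub>j |T\<^sub>j| v < v\<close>: then all errors contract
  in the maximum norm weighted by \<open>v\<close>, and the same inequality makes the interface problem uniquely
  solvable (\<open>async_schur_convergent_if_contracted\<close>, built on \<open>async_nested_sets\<close>).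
  
  The weight comes from the H-matrix \<open>A\<close>. There is a positive vector \<open>w\<close> with \<open>\<langle>A\<rangle> w > 0\<close>
  (\<open>M_matrix_positive_weight\<close>). Its interface part is \<open>v\<close>, its other parts \<open>u\<^sub>i\<close> belong to the interiors
  of the subdomains, and \<open>\<langle>A\<rangle> w > 0\<close> means \<open>|A\<^sub>I\<^sub>\<Gamma>| v < \<langle>A\<^sub>I\<^sub>I\<rangle> u\<^sub>i\<close> in each interior and
  \<open>\<Sum>\<^sub>i |A\<^sub>\<Gamma>\<^sub>I| u\<^sub>i < \<langle>A\<^sub>\<Gamma>\<^sub>\<Gamma>\<rangle> v\<close> on the interface (\<open>schur_block_mat_weights\<close>).
  
  A maximum principle (\<open>comparison_solution_bound\<close>) converts an inequality \<open>|C| z < \<langle>B\<rangle> v\<close> into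
  \<open>|B\<^sup>-\<^sup>1 C| z < v\<close>. In the interiors it bounds \<open>|A\<^sub>I\<^sub>I\<^sup>-\<^sup>1 A\<^sub>I\<^sub>\<Gamma>| v\<close> by \<open>u\<^sub>i\<close>. Applied to \<open>M\<close>, for which the two
  assumptions on the splittings and the interface inequality supply a right-hand side below \<open>\<langle>M\<rangle> v\<close>,
  it gives \<open>\<Sum>\<^sub>j |T\<^sub>j| v < v\<close> (\<open>schur_iteration_contraction\<close>).
\<close>

section \<open>Matrices acting on weights\<close>

text \<open>
  Weight vectors are functions on indices, so that the parts of a weight vector that belong to the
  blocks of a matrix are obtained by shifting the argument.
\<close>

definition act :: "real mat \<Rightarrow> (nat \<Rightarrow> real) \<Rightarrow> nat \<Rightarrow> real" where
  "act B w r = (\<Sum>s<dim_col B. B $$ (r, s) * w s)"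

lemma act_abs:
  "A \<in> carrier_mat k l \<Longrightarrow> r < k \<Longrightarrow> act (mat_abs A) w r = (\<Sum>s<l. norm (A $$ (r, s)) * w s)"
  by (auto simp: act_def mat_abs_def)

lemma act_comparison:
  assumes "A \<in> carrier_mat k k" "r < k"
  shows "act (comparison_mat A) w r =
    norm (A $$ (r, r)) * w r - (\<Sum>s\<in>{..<k} - {r}. norm (A $$ (r, s)) * w s)"
proof -
  have "act (comparison_mat A) w r =
      (\<Sum>s<k. (if r = s then norm (A $$ (r, s)) else - norm (A $$ (r, s))) * w s)"
    using assms by (auto simp: act_def comparison_mat_def)
  also have "\<dots> = norm (A $$ (r, r)) * w r
      + (\<Sum>s\<in>{..<k} - {r}. (if r = s then norm (A $$ (r, s)) else - norm (A $$ (r, s))) * w s)"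
    using assms(2) by (subst sum.remove[of _ r]) auto
  also have "(\<Sum>s\<in>{..<k} - {r}. (if r = s then norm (A $$ (r, s)) else - norm (A $$ (r, s))) * w s)
      = - (\<Sum>s\<in>{..<k} - {r}. norm (A $$ (r, s)) * w s)"
    unfolding sum_negf[symmetric] by (intro sum.cong) auto
  finally show ?thesis by simp
qed

lemma act_abs_nonneg:
  assumes "A \<in> carrier_mat k l" "r < k" "\<And>s. s < l \<Longrightarrow> 0 \<le> w s"
  shows "0 \<le> act (mat_abs A) w r"
  using assms by (auto simp: act_abs intro!: sum_nonneg)

lemma act_abs_mono:
  assumes "A \<in> carrier_mat k l" "r < k" "\<And>s. s < l \<Longrightarrow> w s \<le> w' s"
  shows "act (mat_abs A) w r \<le> act (mat_abs A) w' r"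
  using assms by (auto simp: act_abs intro!: sum_mono mult_left_mono)

lemma act_abs_mult_le:
  assumes A: "A \<in> carrier_mat k l" and B: "B \<in> carrier_mat l q" and r: "r < k"
    and w: "\<And>s. s < q \<Longrightarrow> 0 \<le> w s"
  shows "act (mat_abs (A * B)) w r \<le> act (mat_abs A) (act (mat_abs B) w) r"
proof -
  have "act (mat_abs (A * B)) w r = (\<Sum>s<q. norm ((A * B) $$ (r, s)) * w s)"
    using A B r by (intro act_abs) auto
  also have "\<dots> \<le> (\<Sum>s<q. \<Sum>t<l. norm (A $$ (r, t)) * (norm (B $$ (t, s)) * w s))"
  proof (rule sum_mono)
    fix s assume s: "s \<in> {..<q}"
    have "norm ((A * B) $$ (r, s)) = norm (\<Sum>t<l. A $$ (r, t) * B $$ (t, s))"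
      using A B r s by (auto simp: scalar_prod_def atLeast0LessThan)
    also have "\<dots> \<le> (\<Sum>t<l. norm (A $$ (r, t)) * norm (B $$ (t, s)))"
      by (rule sum_norm_le) (simp add: norm_mult)
    finally have "norm ((A * B) $$ (r, s)) * w s \<le> (\<Sum>t<l. norm (A $$ (r, t)) * norm (B $$ (t, s))) * w s"
      using w s by (intro mult_right_mono) auto
    then show "norm ((A * B) $$ (r, s)) * w s \<le> (\<Sum>t<l. norm (A $$ (r, t)) * (norm (B $$ (t, s)) * w s))"
      by (simp add: sum_distrib_right mult.assoc)
  qed
  also have "\<dots> = (\<Sum>t<l. \<Sum>s<q. norm (A $$ (r, t)) * (norm (B $$ (t, s)) * w s))"
    by (rule sum.swap)
  also have "\<dots> = act (mat_abs A) (act (mat_abs B) w) r"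
    using A B r by (simp add: act_abs[OF A r] act_abs[OF B] sum_distrib_left)
  finally show ?thesis .
qed

lemma act_abs_add_le:
  assumes "A \<in> carrier_mat k l" "B \<in> carrier_mat k l" "r < k" "\<And>s. s < l \<Longrightarrow> 0 \<le> w s"
  shows "act (mat_abs (A + B)) w r \<le> act (mat_abs A) w r + act (mat_abs B) w r"
proof -
  have "act (mat_abs (A + B)) w r = (\<Sum>s<l. norm (A $$ (r, s) + B $$ (r, s)) * w s)"
    using assms(1-3) by (subst act_abs[of _ k l]) auto
  also have "\<dots> \<le> (\<Sum>s<l. (norm (A $$ (r, s)) + norm (B $$ (r, s))) * w s)"
    using assms(4) by (intro sum_mono mult_right_mono norm_triangle_ineq) auto
  finally show ?thesis
    using assms by (simp add: act_abs[of _ k l] distrib_right sum.distrib)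
qed

section \<open>A positive weight for an M-matrix\<close>

lemma pow_mat_commute_Suc:
  assumes "(A :: 'a :: semiring_1 mat) \<in> carrier_mat n n"
  shows "A ^\<^sub>m Suc k = A * A ^\<^sub>m k"
proof (induction k)
  case 0
  show ?case using assms by simp
next
  case (Suc k)
  have "A ^\<^sub>m Suc (Suc k) = A * A ^\<^sub>m k * A" using Suc by simp
  also have "\<dots> = A * (A ^\<^sub>m k * A)"
    using assms by (intro assoc_mult_mat) (auto intro: pow_carrier_mat)
  finally show ?case by simp
qed

text \<open>
  Dividing by \<open>\<beta>\<close> makes the spectral radius smaller than one, and then the powers are bounded
  because every Jordan block has bounded powers.
\<close>

lemma spectral_radius_power_bound:
  assumes A: "A \<in> carrier_mat n n" and n: "0 < n"
    and rad: "spectral_radius A < \<beta>"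
  obtains b where "\<And>k i j. i < n \<Longrightarrow> j < n \<Longrightarrow> norm ((A ^\<^sub>m k) $$ (i, j)) \<le> b * \<beta> ^ k"
proof -
  have "0 \<le> spectral_radius A" using spectral_radius_mem_max(1)[OF A n] by auto
  with rad have \<beta>: "0 < \<beta>" by simp
  define X where "X = complex_of_real (1 / \<beta>) \<cdot>\<^sub>m A"
  have X: "X \<in> carrier_mat n n" using A by (simp add: X_def)
  have ev: "norm e < 1" if "eigenvalue X e" for e
  proof -
    from that obtain v where v: "v \<in> carrier_vec n" "v \<noteq> 0\<^sub>v n" "X *\<^sub>v v = e \<cdot>\<^sub>v v"
      using X by (auto simp: eigenvalue_def eigenvector_def)
    have "A *\<^sub>v v = complex_of_real \<beta> \<cdot>\<^sub>v (X *\<^sub>v v)"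
      using A v(1) \<beta> by (intro eq_vecI) (auto simp: X_def scalar_prod_def sum_distrib_left)
    also have "\<dots> = (complex_of_real \<beta> * e) \<cdot>\<^sub>v v" using v by (auto simp: smult_smult_assoc)
    finally have "eigenvalue A (complex_of_real \<beta> * e)"
      using A v by (auto simp: eigenvalue_def eigenvector_def)
    then have "norm (complex_of_real \<beta> * e) \<le> spectral_radius A"
      by (intro spectral_radius_mem_max(2)[OF A n]) (auto simp: spectrum_def)
    moreover have "norm (complex_of_real \<beta> * e) = \<beta> * norm e" using \<beta> by (simp add: norm_mult)
    ultimately have "\<beta> * norm e < \<beta>" using rad by linarith
    then show ?thesis using \<beta> by simp
  qed
  have "spectral_radius X < 1"
    using spectral_radius_mem_max(1)[OF X n] ev by (auto simp: spectrum_def)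
  from spectral_radius_jnf_norm_bound_less_1_upper_triangular[OF X this]
  obtain b where b: "\<And>k. norm_bound (X ^\<^sub>m k) b" by blast
  \<comment> \<open>The bound for \<open>X = A / \<beta>\<close> is carried back to \<open>A\<close>.\<close>
  have AX: "A ^\<^sub>m k = complex_of_real (\<beta> ^ k) \<cdot>\<^sub>m X ^\<^sub>m k" for k
  proof (induction k)
    case 0
    show ?case using A X by (intro eq_matI) auto
  next
    case (Suc k)
    have Ak: "X ^\<^sub>m k \<in> carrier_mat n n" using X by (rule pow_carrier_mat)
    have AX: "A = complex_of_real \<beta> \<cdot>\<^sub>m X" using A \<beta> by (intro eq_matI) (auto simp: X_def)
    have "A ^\<^sub>m Suc k = complex_of_real (\<beta> ^ k) \<cdot>\<^sub>m X ^\<^sub>m k * (complex_of_real \<beta> \<cdot>\<^sub>m X)"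
      using Suc AX by simp
    also have "\<dots> = complex_of_real (\<beta> ^ Suc k) \<cdot>\<^sub>m (X ^\<^sub>m k * X)"
      using Ak X by (intro eq_matI) (auto simp: scalar_prod_def sum_distrib_left ac_simps)
    finally show ?case by simp
  qed
  show ?thesis
  proof (rule that)
    fix k i j assume ij: "i < n" "j < n"
    have Xk: "X ^\<^sub>m k \<in> carrier_mat n n" using X by (rule pow_carrier_mat)
    have "norm ((A ^\<^sub>m k) $$ (i, j)) = \<beta> ^ k * norm ((X ^\<^sub>m k) $$ (i, j))"
      using carrier_matD[OF Xk] ij \<beta> by (simp add: AX norm_mult norm_power)
    also have "\<dots> \<le> \<beta> ^ k * b"
      using b[of k] carrier_matD[OF Xk] ij \<beta>
      by (intro mult_left_mono) (auto simp: norm_bound_def simp del: pow_mat_dim)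
    finally show "norm ((A ^\<^sub>m k) $$ (i, j)) \<le> b * \<beta> ^ k" by (simp add: mult.commute)
  qed
qed

text \<open>
  The inverse of an M-matrix \<open>B = \<alpha> I - C\<close> is given by the Neumann series in \<open>C / \<alpha>\<close>. A partial sum
  of it, applied to the all-ones vector \<open>e\<close>, already serves as the weight \<open>w\<close>: the sum telescopes to
  \<open>B w = \<alpha> (e - (C / \<alpha>)\<^sup>K e)\<close>, which is positive as soon as \<open>(C / \<alpha>)\<^sup>K e < e\<close>.
\<close>

lemma M_matrix_positive_weight:
  assumes M: "M_matrix B" and B: "B \<in> carrier_mat N N"
  obtains w where "\<And>r. r < N \<Longrightarrow> 0 < w r" "\<And>r. r < N \<Longrightarrow> 0 < act B w r"
proof (cases "N = 0")
  case True
  then show ?thesis using that[of "\<lambda>_. 1"] by simp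
next
  case False
  then have N: "0 < N" by simp
  from M B obtain \<alpha> :: real where
    nonneg: "0\<^sub>m N N \<le> \<alpha> \<cdot>\<^sub>m 1\<^sub>m N - B" and
    rad: "spectral_radius (map_mat complex_of_real (\<alpha> \<cdot>\<^sub>m 1\<^sub>m N - B)) < \<alpha>"
    by (auto simp: M_matrix_def)
  define C where "C = \<alpha> \<cdot>\<^sub>m 1\<^sub>m N - B"
  let ?C = "map_mat complex_of_real C"
  have C: "C \<in> carrier_mat N N" unfolding C_def using B by (rule minus_carrier_mat)
  have cC: "?C \<in> carrier_mat N N" using C by simp
  have C_nonneg: "0 \<le> C $$ (r, s)" if "r < N" "s < N" for r s
    using nonneg that by (auto simp: less_eq_mat_def C_def[symmetric])
  have "0 \<le> spectral_radius ?C" using spectral_radius_mem_max(1)[OF cC N] by auto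
  \<comment> \<open>Powers of \<open>C\<close> grow at most like \<open>\<beta> ^ k\<close>; the gap between \<open>\<beta>\<close> and \<open>\<alpha>\<close> makes those of \<open>C / \<alpha>\<close>
    tend to zero.\<close>
  with rad obtain \<beta> where \<beta>: "spectral_radius ?C < \<beta>" "0 < \<beta>" "\<beta> < \<alpha>"
    by (metis C_def dense less_trans order_le_less_trans)
  obtain b where b: "\<And>k i j. i < N \<Longrightarrow> j < N \<Longrightarrow> norm ((?C ^\<^sub>m k) $$ (i, j)) \<le> b * \<beta> ^ k"
    using spectral_radius_power_bound[OF cC N \<beta>(1)] by blast
  \<comment> \<open>\<open>f k\<close> is \<open>C\<^sup>k\<close> applied to the all-ones vector.\<close>
  define f where "f k r = (\<Sum>s<N. (C ^\<^sub>m k) $$ (r, s))" for k r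
  have Ck: "C ^\<^sub>m k \<in> carrier_mat N N" for k using C by (rule pow_carrier_mat)
  have f_0: "f 0 r = 1" if "r < N" for r using that C by (simp add: f_def)
  have f_Suc: "f (Suc k) r = (\<Sum>s<N. C $$ (r, s) * f k s)" if r: "r < N" for k r
  proof -
    have "f (Suc k) r = (\<Sum>t<N. \<Sum>s<N. C $$ (r, s) * (C ^\<^sub>m k) $$ (s, t))"
      unfolding f_def pow_mat_commute_Suc[OF C] using C Ck[of k] r
      by (intro sum.cong) (auto simp: scalar_prod_def atLeast0LessThan)
    also have "\<dots> = (\<Sum>s<N. \<Sum>t<N. C $$ (r, s) * (C ^\<^sub>m k) $$ (s, t))" by (rule sum.swap)
    finally show ?thesis by (simp add: f_def sum_distrib_left)
  qed
  have f_nonneg: "0 \<le> f k r" if "r < N" for k r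
    using that
  proof (induction k arbitrary: r)
    case (Suc k)
    then show ?case by (auto simp: f_Suc intro!: sum_nonneg mult_nonneg_nonneg C_nonneg)
  qed (simp add: f_0)
  have f_bound: "f k r \<le> real N * b * \<beta> ^ k" if r: "r < N" for k r
  proof -
    have pow: "?C ^\<^sub>m k = map_mat complex_of_real (C ^\<^sub>m k)"
      using of_real_hom.mat_hom_pow[OF C, where 'a = complex] by simp
    have "f k r \<le> (\<Sum>s<N. b * \<beta> ^ k)"
      unfolding f_def
    proof (rule sum_mono)
      fix s assume "s \<in> {..<N}"
      then have "norm (complex_of_real ((C ^\<^sub>m k) $$ (r, s))) \<le> b * \<beta> ^ k"
        using b[of r s k] r carrier_matD[OF Ck[of k]] by (simp add: pow del: norm_of_real)
      then show "(C ^\<^sub>m k) $$ (r, s) \<le> b * \<beta> ^ k" by simp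
    qed
    then show ?thesis by simp
  qed
  have "(\<lambda>k. real N * b * (\<beta> / \<alpha>) ^ k) \<longlonglongrightarrow> real N * b * 0"
    using \<beta> by (intro tendsto_mult tendsto_const LIMSEQ_power_zero) auto
  then have "\<forall>\<^sub>F k in sequentially. real N * b * (\<beta> / \<alpha>) ^ k < 1"
    by (intro order_tendstoD(2)[where y = 0]) auto
  then obtain K where K: "real N * b * (\<beta> / \<alpha>) ^ K < 1"
    by (auto simp: eventually_sequentially)
  have fK: "f K r / \<alpha> ^ K < 1" if "r < N" for r
  proof -
    have "f K r / \<alpha> ^ K \<le> real N * b * \<beta> ^ K / \<alpha> ^ K"
      using \<beta> f_bound[OF that] by (intro divide_right_mono) auto
    then show ?thesis using K by (simp add: power_divide)
  qed
  define w where "w r = (\<Sum>k<K. f k r / \<alpha> ^ k)" for r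
  \<comment> \<open>For \<open>K = 0\<close> the ratio would be \<open>1\<close>; a nonempty partial sum contains the all-ones vector.\<close>
  have "0 < K"
    using fK[OF N] f_0[OF N] by (cases K) auto
  show ?thesis
  proof (rule that)
    fix r assume r: "r < N"
    have "f 0 r / \<alpha> ^ 0 \<le> w r"
      unfolding w_def using \<open>0 < K\<close> r \<beta> by (intro member_le_sum) (auto intro!: divide_nonneg_nonneg f_nonneg)
    then show "0 < w r" using r by (simp add: f_0)
    have "(\<Sum>s<N. C $$ (r, s) * w s) = (\<Sum>s<N. \<Sum>k<K. C $$ (r, s) * f k s / \<alpha> ^ k)"
      by (simp add: w_def sum_distrib_left)
    also have "\<dots> = (\<Sum>k<K. \<Sum>s<N. C $$ (r, s) * f k s / \<alpha> ^ k)" by (rule sum.swap)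
    also have "\<dots> = (\<Sum>k<K. f (Suc k) r / \<alpha> ^ k)"
      using r by (simp add: f_Suc sum_divide_distrib)
    finally have Cw: "(\<Sum>s<N. C $$ (r, s) * w s) = (\<Sum>k<K. f (Suc k) r / \<alpha> ^ k)" .
    have "act B w r = (\<Sum>s<N. \<alpha> * (if s = r then w s else 0) - C $$ (r, s) * w s)"
      unfolding act_def using B r by (intro sum.cong) (auto simp: C_def algebra_simps)
    also have "\<dots> = \<alpha> * w r - (\<Sum>s<N. C $$ (r, s) * w s)"
      using r by (simp add: sum_subtractf flip: sum_distrib_left)
    also have "\<dots> = (\<Sum>k<K. \<alpha> * (f k r / \<alpha> ^ k - f (Suc k) r / \<alpha> ^ Suc k))"
    proof -
      have "\<alpha> * w r = (\<Sum>k<K. \<alpha> * (f k r / \<alpha> ^ k))" by (simp only: w_def sum_distrib_left)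
      moreover have "(\<Sum>k<K. f (Suc k) r / \<alpha> ^ k) = (\<Sum>k<K. \<alpha> * (f (Suc k) r / \<alpha> ^ Suc k))"
        using \<beta> by (intro sum.cong) auto
      ultimately show ?thesis by (simp only: Cw sum_subtractf right_diff_distrib)
    qed
    also have "\<dots> = \<alpha> * (f 0 r / \<alpha> ^ 0 - f K r / \<alpha> ^ K)"
      unfolding sum_distrib_left[symmetric] by (subst sum_lessThan_telescope') simp
    also have "\<dots> > 0" using fK[OF r] f_0[OF r] \<beta> by simp
    finally show "0 < act B w r" .
  qed
qed

section \<open>A maximum principle for comparison matrices\<close>

text \<open>
  A maximum principle. At an index \<open>h\<close> where the ratio \<open>q / v\<close> is maximal, with value \<open>t\<close>, all other
  entries satisfy \<open>q \<le> t v\<close>. If \<open>t \<ge> 1\<close>, then also \<open>g \<le> t g\<close>, and row \<open>h\<close> of \<open>sub\<close> contradicts \<open>t\<close> times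
  row \<open>h\<close> of \<open>super\<close>.
\<close>

lemma comparison_domination:
  fixes c :: "nat \<Rightarrow> nat \<Rightarrow> real"
  assumes c: "\<And>r s. r < k \<Longrightarrow> s < k \<Longrightarrow> 0 \<le> c r s"
    and v: "\<And>r. r < k \<Longrightarrow> 0 < v r"
    and g: "\<And>r. r < k \<Longrightarrow> 0 \<le> g r"
    and super: "\<And>r. r < k \<Longrightarrow> g r < c r r * v r - (\<Sum>s\<in>{..<k} - {r}. c r s * v s)"
    and sub: "\<And>r. r < k \<Longrightarrow> c r r * q r \<le> (\<Sum>s\<in>{..<k} - {r}. c r s * q s) + g r"
    and r: "r < k"
  shows "q r < v r"
proof (rule ccontr)
  assume "\<not> q r < v r"
  define t where "t = Max ((\<lambda>s. q s / v s) ` {..<k})"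
  have ratio: "q s / v s \<le> t" if "s < k" for s using that by (auto simp: t_def)
  have le: "q s \<le> t * v s" if "s < k" for s
    using ratio[OF that] v[OF that] by (simp add: pos_divide_le_eq)
  have "1 \<le> q r / v r" using \<open>\<not> q r < v r\<close> v[OF r] by simp
  with ratio[OF r] have t: "1 \<le> t" by linarith
  have "t \<in> (\<lambda>s. q s / v s) ` {..<k}" unfolding t_def using r by (intro Max_in) auto
  then obtain h where h: "h < k" "t = q h / v h" by auto
  with v[of h] have qh: "q h = t * v h" by simp
  have "c h h * q h \<le> (\<Sum>s\<in>{..<k} - {h}. c h s * q s) + g h" using sub h(1) .
  also have "\<dots> \<le> (\<Sum>s\<in>{..<k} - {h}. c h s * (t * v s)) + t * g h"
  proof (rule add_mono)
    show "(\<Sum>s\<in>{..<k} - {h}. c h s * q s) \<le> (\<Sum>s\<in>{..<k} - {h}. c h s * (t * v s))"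
      using c h le by (intro sum_mono mult_left_mono) auto
    show "g h \<le> t * g h" using mult_right_mono[OF t g[OF h(1)]] by simp
  qed
  also have "\<dots> = t * ((\<Sum>s\<in>{..<k} - {h}. c h s * v s) + g h)"
    by (simp add: sum_distrib_left distrib_left mult.left_commute)
  also have "\<dots> < t * (c h h * v h)" using super[OF h(1)] t by (intro mult_strict_left_mono) auto
  finally show False by (simp add: qh)
qed

text \<open>
  Moving the off-diagonal terms of \<open>B X = C\<close> to the right and taking norms shows
  \<open>\<langle>B\<rangle> (|X| z) \<le> |C| z\<close>, and the maximum principle applies. The lemma is used
  for the interior blocks, where \<open>C\<close> is the coupling to the interface, and for \<open>M\<close>, where \<open>C\<close> is
  the identity.
\<close>

lemma comparison_solution_bound:
  assumes B: "B \<in> carrier_mat k k" and X: "X \<in> carrier_mat k l" and BX: "B * X = C"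
    and v: "\<And>r. r < k \<Longrightarrow> 0 < v r" and z: "\<And>s. s < l \<Longrightarrow> 0 \<le> z s"
    and super: "\<And>r. r < k \<Longrightarrow> act (mat_abs C) z r < act (comparison_mat B) v r"
    and r: "r < k"
  shows "act (mat_abs X) z r < v r"
proof (rule comparison_domination[where k = k and g = "act (mat_abs C) z"
        and c = "\<lambda>r s. norm (B $$ (r, s))"])
  have C: "C \<in> carrier_mat k l" using mult_carrier_mat[OF B X] by (simp only: BX)
  fix r assume r: "r < k"
  show "0 \<le> act (mat_abs C) z r" using C r z by (rule act_abs_nonneg)
  show "act (mat_abs C) z r < norm (B $$ (r, r)) * v r - (\<Sum>s\<in>{..<k} - {r}. norm (B $$ (r, s)) * v s)"
    using super[OF r] by (simp add: act_comparison[OF B r])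
  have entry: "norm (B $$ (r, r)) * norm (X $$ (r, s))
      \<le> (\<Sum>t\<in>{..<k} - {r}. norm (B $$ (r, t)) * norm (X $$ (t, s))) + norm (C $$ (r, s))"
    if s: "s < l" for s
  proof -
    have "(B * X) $$ (r, s) = (\<Sum>t<k. B $$ (r, t) * X $$ (t, s))"
      using carrier_matD[OF B] carrier_matD[OF X] r s by (simp add: scalar_prod_def atLeast0LessThan)
    then have "C $$ (r, s) = (\<Sum>t<k. B $$ (r, t) * X $$ (t, s))" by (simp only: BX)
    also have "\<dots> = B $$ (r, r) * X $$ (r, s) + (\<Sum>t\<in>{..<k} - {r}. B $$ (r, t) * X $$ (t, s))"
      using r by (subst sum.remove[of _ r]) auto
    finally have "B $$ (r, r) * X $$ (r, s) =
        C $$ (r, s) - (\<Sum>t\<in>{..<k} - {r}. B $$ (r, t) * X $$ (t, s))" by (simp only: eq_diff_eq)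
    then have "norm (B $$ (r, r)) * norm (X $$ (r, s))
        \<le> norm (C $$ (r, s)) + norm (\<Sum>t\<in>{..<k} - {r}. B $$ (r, t) * X $$ (t, s))"
      unfolding norm_mult[symmetric] by (simp only: norm_triangle_ineq4)
    also have "norm (\<Sum>t\<in>{..<k} - {r}. B $$ (r, t) * X $$ (t, s))
        \<le> (\<Sum>t\<in>{..<k} - {r}. norm (B $$ (r, t)) * norm (X $$ (t, s)))"
      by (rule sum_norm_le) (simp add: norm_mult)
    finally show ?thesis by simp
  qed
  have "norm (B $$ (r, r)) * act (mat_abs X) z r
      = (\<Sum>s<l. norm (B $$ (r, r)) * norm (X $$ (r, s)) * z s)"
    by (simp add: act_abs[OF X r] sum_distrib_left mult.assoc)
  also have "\<dots> \<le> (\<Sum>s<l. ((\<Sum>t\<in>{..<k} - {r}. norm (B $$ (r, t)) * norm (X $$ (t, s)))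
      + norm (C $$ (r, s))) * z s)"
    using z entry by (intro sum_mono mult_right_mono) auto
  also have "\<dots> = (\<Sum>s<l. \<Sum>t\<in>{..<k} - {r}. norm (B $$ (r, t)) * (norm (X $$ (t, s)) * z s))
      + act (mat_abs C) z r"
    by (simp add: act_abs[OF C r] distrib_right sum.distrib sum_distrib_right mult.assoc)
  also have "(\<Sum>s<l. \<Sum>t\<in>{..<k} - {r}. norm (B $$ (r, t)) * (norm (X $$ (t, s)) * z s))
      = (\<Sum>t\<in>{..<k} - {r}. norm (B $$ (r, t)) * act (mat_abs X) z t)"
    by (subst sum.swap) (simp add: act_abs[OF X] sum_distrib_left)
  finally show "norm (B $$ (r, r)) * act (mat_abs X) z r \<le>
      (\<Sum>t\<in>{..<k} - {r}. norm (B $$ (r, t)) * act (mat_abs X) z t) + act (mat_abs C) z r" .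
qed (use v r in auto)

section \<open>Positions in block matrices\<close>

text \<open>
  Index at which block \<open>i\<close> starts when the blocks \<open>a\<close>, \<open>a + 1\<close>, ... are placed one after the other.
  The first block is a parameter because lists of blocks are taken apart from the front.
\<close>

definition block_offset :: "(nat \<Rightarrow> nat) \<Rightarrow> nat \<Rightarrow> nat \<Rightarrow> nat" where
  "block_offset m a i = (\<Sum>j\<in>{a..<i}. m j)"

lemma block_offset_self [simp]: "block_offset m a a = 0"
  by (simp add: block_offset_def)

lemma block_offset_Cons: "a < i \<Longrightarrow> block_offset m a i = m a + block_offset m (Suc a) i"
  by (simp add: block_offset_def sum.atLeast_Suc_lessThan)

lemma block_offset_bound:
  assumes "a \<le> i" "i < b" "r < m i"
  shows "block_offset m a i + r < block_offset m a b"
proof -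
  have "block_offset m a i + m i = block_offset m a (Suc i)"
    using assms(1) by (simp add: block_offset_def)
  also have "\<dots> \<le> block_offset m a b"
    unfolding block_offset_def using assms by (intro sum_mono2) auto
  finally show ?thesis using assms(3) by simp
qed

lemma sum_lessThan_add: "(\<Sum>c<x + y. h c) = (\<Sum>c<x. h c) + (\<Sum>c<y. h (x + c))" for x y :: nat
  by (induction y) (auto simp: ac_simps)

lemma sum_over_blocks:
  "(\<Sum>c<block_offset m a b. h c) = (\<Sum>i\<in>{a..<b}. \<Sum>s<m i. h (block_offset m a i + s))"
proof (induction b)
  case (Suc b)
  show ?case
  proof (cases "a \<le> b")
    case True
    then have "block_offset m a (Suc b) = block_offset m a b + m b" by (simp add: block_offset_def)
    then show ?thesis using True Suc by (simp add: sum_lessThan_add)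
  qed (simp add: block_offset_def)
qed (simp add: block_offset_def)

lemma diag_block_mat_carrier:
  assumes "\<And>i. a \<le> i \<Longrightarrow> i < b \<Longrightarrow> F i \<in> carrier_mat (m i) (m i)"
  shows "diag_block_mat (map F [a..<b]) \<in> carrier_mat (block_offset m a b) (block_offset m a b)"
  using assms
proof (induction "b - a" arbitrary: a)
  case 0
  then show ?case by (auto simp: block_offset_def)
next
  case (Suc d)
  have ab: "a < b" using Suc.hyps(2) by simp
  have "diag_block_mat (map F [Suc a..<b]) \<in>
      carrier_mat (block_offset m (Suc a) b) (block_offset m (Suc a) b)"
    using Suc.hyps(2) Suc.prems by (intro Suc.hyps(1)) auto
  moreover have "F a \<in> carrier_mat (m a) (m a)" using Suc.prems ab by auto
  ultimately show ?case using ab by (auto simp: upt_conv_Cons Let_def block_offset_Cons)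
qed

lemma diag_block_mat_entry:
  assumes "\<And>i. a \<le> i \<Longrightarrow> i < b \<Longrightarrow> F i \<in> carrier_mat (m i) (m i)"
    and "a \<le> i" "i < b" "a \<le> j" "j < b" "r < m i" "s < m j"
  shows "diag_block_mat (map F [a..<b]) $$ (block_offset m a i + r, block_offset m a j + s) =
    (if i = j then F i $$ (r, s) else 0)"
  using assms
proof (induction "b - a" arbitrary: a)
  case 0
  then show ?case by auto
next
  case (Suc d)
  have ab: "a < b" using Suc.hyps(2) by simp
  define D where "D = diag_block_mat (map F [Suc a..<b])"
  have D: "D \<in> carrier_mat (block_offset m (Suc a) b) (block_offset m (Suc a) b)"
    unfolding D_def using Suc.prems(1) by (intro diag_block_mat_carrier) auto
  have Fa: "F a \<in> carrier_mat (m a) (m a)" using Suc.prems(1) ab by auto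
  have split: "diag_block_mat (map F [a..<b]) =
      four_block_mat (F a) (0\<^sub>m (dim_row (F a)) (dim_col D)) (0\<^sub>m (dim_row D) (dim_col (F a))) D"
    using ab by (simp add: upt_conv_Cons D_def Let_def)
  have D_entry: "D $$ (block_offset m (Suc a) i + r, block_offset m (Suc a) j + s) =
      (if i = j then F i $$ (r, s) else 0)" if "a < i" "a < j"
    unfolding D_def using Suc.hyps(2) Suc.prems that by (intro Suc.hyps(1)) auto
  have bound: "a < i \<Longrightarrow> block_offset m (Suc a) i + r < block_offset m (Suc a) b"
    "a < j \<Longrightarrow> block_offset m (Suc a) j + s < block_offset m (Suc a) b"
    using Suc.prems by (auto intro!: block_offset_bound)
  have row: "block_offset m a i + r = (if a = i then r else m a + (block_offset m (Suc a) i + r))"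
    and col: "block_offset m a j + s = (if a = j then s else m a + (block_offset m (Suc a) j + s))"
    using Suc.prems(2,4) by (auto simp: block_offset_Cons)
  show ?case
    unfolding split row col
    using Suc.prems(2-) carrier_matD[OF D] carrier_matD[OF Fa] D_entry bound
    by (cases "a = i"; cases "a = j") simp_all
qed

lemma foldr_append_rows_carrier:
  assumes "\<And>i. a \<le> i \<Longrightarrow> i < b \<Longrightarrow> F i \<in> carrier_mat (m i) n"
  shows "foldr (@\<^sub>r) (map F [a..<b]) (0\<^sub>m 0 n) \<in> carrier_mat (block_offset m a b) n"
  using assms
proof (induction "b - a" arbitrary: a)
  case 0
  then show ?case by (auto simp: block_offset_def)
next
  case (Suc d)
  have ab: "a < b" using Suc.hyps(2) by simp
  have "foldr (@\<^sub>r) (map F [Suc a..<b]) (0\<^sub>m 0 n) \<in> carrier_mat (block_offset m (Suc a) b) n"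
    using Suc.hyps(2) Suc.prems by (intro Suc.hyps(1)) auto
  moreover have "F a \<in> carrier_mat (m a) n" using Suc.prems ab by auto
  ultimately show ?case using ab by (auto simp: upt_conv_Cons block_offset_Cons)
qed

lemma foldr_append_rows_entry:
  assumes "\<And>i. a \<le> i \<Longrightarrow> i < b \<Longrightarrow> F i \<in> carrier_mat (m i) n"
    and "a \<le> i" "i < b" "r < m i" "s < n"
  shows "foldr (@\<^sub>r) (map F [a..<b]) (0\<^sub>m 0 n) $$ (block_offset m a i + r, s) = F i $$ (r, s)"
  using assms
proof (induction "b - a" arbitrary: a)
  case 0
  then show ?case by auto
next
  case (Suc d)
  have ab: "a < b" using Suc.hyps(2) by simp
  define D where "D = foldr (@\<^sub>r) (map F [Suc a..<b]) (0\<^sub>m 0 n)"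
  have D: "D \<in> carrier_mat (block_offset m (Suc a) b) n"
    unfolding D_def using Suc.prems(1) by (intro foldr_append_rows_carrier) auto
  have Fa: "F a \<in> carrier_mat (m a) n" using Suc.prems(1) ab by auto
  have split: "foldr (@\<^sub>r) (map F [a..<b]) (0\<^sub>m 0 n) = F a @\<^sub>r D"
    using ab by (simp add: upt_conv_Cons D_def)
  have D_entry: "D $$ (block_offset m (Suc a) i + r, s) = F i $$ (r, s)" if "a < i"
    unfolding D_def using Suc.hyps(2) Suc.prems that by (intro Suc.hyps(1)) auto
  have bound: "a < i \<Longrightarrow> block_offset m (Suc a) i + r < block_offset m (Suc a) b"
    using Suc.prems by (auto intro!: block_offset_bound)
  have row: "block_offset m a i + r = (if a = i then r else m a + (block_offset m (Suc a) i + r))"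
    using Suc.prems(2) by (auto simp: block_offset_Cons)
  show ?case
    unfolding split append_rows_def row
    using Suc.prems(2-) carrier_matD[OF D] carrier_matD[OF Fa] D_entry bound
    by (cases "a = i") simp_all
qed

section \<open>Weights for the blocks of an H-matrix\<close>

lemma comparison_mat_entry:
  "A \<in> carrier_mat k l \<Longrightarrow> r < k \<Longrightarrow> s < l \<Longrightarrow>
    comparison_mat A $$ (r, s) = (if r = s then norm (A $$ (r, s)) else - norm (A $$ (r, s)))"
  by (auto simp: comparison_mat_def)

text \<open>
  A positive weight for \<open>\<langle>A\<rangle>\<close> splits into interior weights \<open>u\<^sub>i\<close> and an interface weight \<open>v\<close>. Since
  the zero blocks of \<open>A\<close> contribute nothing, positivity of \<open>\<langle>A\<rangle>\<close> times the weight says, row block by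
  row block, that \<open>\<langle>A\<^sub>I\<^sub>I\<rangle> u\<^sub>i\<close> exceeds \<open>|A\<^sub>I\<^sub>\<Gamma>| v\<close> and that \<open>\<langle>A\<^sub>\<Gamma>\<^sub>\<Gamma>\<rangle> v\<close> exceeds the sum of the \<open>|A\<^sub>\<Gamma>\<^sub>I| u\<^sub>i\<close>.
\<close>

lemma schur_block_mat_weights:
  assumes AII: "\<And>i. i \<in> {1..p} \<Longrightarrow> AII i \<in> carrier_mat (m i) (m i)"
    and AIG: "\<And>i. i \<in> {1..p} \<Longrightarrow> AIG i \<in> carrier_mat (m i) n"
    and AGI: "\<And>i. i \<in> {1..p} \<Longrightarrow> AGI i \<in> carrier_mat n (m i)"
    and H: "H_matrix (schur_block_mat p n AII AIG AGI AGG)"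
  obtains u v where
    "\<And>i r. i \<in> {1..p} \<Longrightarrow> r < m i \<Longrightarrow> 0 < u i r"
    "\<And>r. r < n \<Longrightarrow> 0 < v r"
    "\<And>i r. i \<in> {1..p} \<Longrightarrow> r < m i \<Longrightarrow>
      act (mat_abs (AIG i)) v r < act (comparison_mat (AII i)) (u i) r"
    "\<And>r. r < n \<Longrightarrow>
      (\<Sum>i\<in>{1..p}. act (mat_abs (AGI i)) (u i) r) < act (comparison_mat (mat_sum p n AGG)) v r"
proof -
  define pos where "pos = block_offset m 1"
  define L where "L = pos (Suc p)"
  define D where "D = diag_block_mat (map AII [1..<Suc p])"
  define R where "R = stack_rows p n AIG"
  define C where "C = stack_cols p n AGI"
  define G where "G = mat_sum p n AGG"
  define A where "A = schur_block_mat p n AII AIG AGI AGG"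
  have A_blocks: "A = four_block_mat D R C G"
    by (simp add: A_def schur_block_mat_def D_def R_def C_def G_def)
  have D: "D \<in> carrier_mat L L"
    unfolding D_def L_def pos_def using AII by (intro diag_block_mat_carrier) auto
  have R: "R \<in> carrier_mat L n"
    unfolding R_def L_def pos_def stack_rows_def using AIG by (intro foldr_append_rows_carrier) auto
  have Ct: "stack_rows p n (\<lambda>i. (AGI i)\<^sup>T) \<in> carrier_mat L n"
    unfolding L_def pos_def stack_rows_def using AGI by (intro foldr_append_rows_carrier) auto
  then have C: "C \<in> carrier_mat n L" by (simp add: C_def stack_cols_def)
  have G: "G \<in> carrier_mat n n" by (simp add: G_def mat_sum_def)
  have A: "A \<in> carrier_mat (L + n) (L + n)" unfolding A_blocks using D G by auto
  define E where "E = comparison_mat A"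
  have E: "E \<in> carrier_mat (L + n) (L + n)" using A by (auto simp: E_def comparison_mat_def)
  note E_entry = comparison_mat_entry[OF A, folded E_def]
  have lt: "pos i + r < L" if "i \<in> {1..p}" "r < m i" for i r
    unfolding pos_def L_def using that by (intro block_offset_bound) auto
  have E_II: "E $$ (pos i + r, pos j + s) = (if i = j then comparison_mat (AII i) $$ (r, s) else 0)"
    if "i \<in> {1..p}" "j \<in> {1..p}" "r < m i" "s < m j" for i j r s
  proof -
    have "D $$ (pos i + r, pos j + s) = (if i = j then AII i $$ (r, s) else 0)"
      unfolding D_def pos_def using that AII by (intro diag_block_mat_entry) auto
    then have "A $$ (pos i + r, pos j + s) = (if i = j then AII i $$ (r, s) else 0)"
      unfolding A_blocks using lt[OF that(1,3)] lt[OF that(2,4)] carrier_matD[OF D] by simp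
    \<comment> \<open>For \<open>i \<noteq> j\<close> both branches of the conditional vanish, so it need not be decided whether the two
      positions coincide.\<close>
    moreover have "E $$ (pos i + r, pos j + s) = (if pos i + r = pos j + s
        then norm (A $$ (pos i + r, pos j + s)) else - norm (A $$ (pos i + r, pos j + s)))"
      using lt[OF that(1,3)] lt[OF that(2,4)] by (intro E_entry) auto
    ultimately show ?thesis
      using comparison_mat_entry[OF AII[OF that(1)] that(3), of s] that(4)
      by (cases "i = j")
        (simp_all only: simp_thms if_True if_False if_cancel norm_zero minus_zero add_left_cancel)
  qed
  have E_IG: "E $$ (pos i + r, L + s) = - norm (AIG i $$ (r, s))"
    if "i \<in> {1..p}" "r < m i" "s < n" for i r s
  proof -
    have "R $$ (pos i + r, s) = AIG i $$ (r, s)"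
      unfolding R_def pos_def stack_rows_def using that AIG by (intro foldr_append_rows_entry) auto
    then have "A $$ (pos i + r, L + s) = AIG i $$ (r, s)"
      unfolding A_blocks using lt[OF that(1,2)] that(3) carrier_matD[OF D] carrier_matD[OF G] by simp
    then show ?thesis using lt[OF that(1,2)] that(3) by (simp add: E_entry)
  qed
  have E_GI: "E $$ (L + r, pos i + s) = - norm (AGI i $$ (r, s))"
    if "i \<in> {1..p}" "r < n" "s < m i" for i r s
  proof -
    have "stack_rows p n (\<lambda>i. (AGI i)\<^sup>T) $$ (pos i + s, r) = (AGI i)\<^sup>T $$ (s, r)"
      unfolding pos_def stack_rows_def using that AGI by (intro foldr_append_rows_entry) auto
    then have "C $$ (r, pos i + s) = AGI i $$ (r, s)"
      using carrier_matD[OF Ct] carrier_matD[OF AGI[OF that(1)]] that(2,3) lt[OF that(1,3)]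
      by (simp add: C_def stack_cols_def)
    then have "A $$ (L + r, pos i + s) = AGI i $$ (r, s)"
      unfolding A_blocks using lt[OF that(1,3)] that(2) carrier_matD[OF D] carrier_matD[OF G] by simp
    then show ?thesis using lt[OF that(1,3)] that(2) by (simp add: E_entry)
  qed
  have E_GG: "E $$ (L + r, L + s) = comparison_mat G $$ (r, s)" if "r < n" "s < n" for r s
  proof -
    have "A $$ (L + r, L + s) = G $$ (r, s)"
      unfolding A_blocks using that carrier_matD[OF D] carrier_matD[OF G] by simp
    then show ?thesis
      using that by (cases "r = s") (simp_all add: E_entry comparison_mat_entry[OF G])
  qed
  obtain w where w: "\<And>c. c < L + n \<Longrightarrow> 0 < w c" and Ew: "\<And>c. c < L + n \<Longrightarrow> 0 < act E w c"
    using M_matrix_positive_weight[OF _ E] H unfolding H_matrix_def E_def A_def by blast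
  define u where "u i s = w (pos i + s)" for i s
  define v where "v s = w (L + s)" for s
  have blocks: "act E w c = (\<Sum>i\<in>{1..p}. \<Sum>s<m i. E $$ (c, pos i + s) * u i s)
      + (\<Sum>s<n. E $$ (c, L + s) * v s)" for c
    using E by (simp add: act_def u_def v_def L_def pos_def sum_lessThan_add sum_over_blocks
        atLeastLessThanSuc_atLeastAtMost)
  show ?thesis
  proof (rule that)
    show "0 < u i r" if "i \<in> {1..p}" "r < m i" for i r
      using w lt[OF that] by (simp add: u_def)
    show "0 < v r" if "r < n" for r using w that by (simp add: v_def)
    show "act (mat_abs (AIG i)) v r < act (comparison_mat (AII i)) (u i) r"
      if i: "i \<in> {1..p}" and r: "r < m i" for i r
    proof -
      have "(\<Sum>j\<in>{1..p}. \<Sum>s<m j. E $$ (pos i + r, pos j + s) * u j s)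
          = (\<Sum>j\<in>{1..p}. if j = i then act (comparison_mat (AII i)) (u i) r else 0)"
        using i r AII[OF i]
        by (intro sum.cong refl) (auto simp: E_II act_def comparison_mat_def)
      also have "\<dots> = act (comparison_mat (AII i)) (u i) r" using i by simp
      finally have "act E w (pos i + r) = act (comparison_mat (AII i)) (u i) r - act (mat_abs (AIG i)) v r"
        unfolding blocks using i r by (simp add: E_IG act_abs[OF AIG[OF i] r] sum_negf)
      then show ?thesis using Ew[of "pos i + r"] lt[OF i r] by simp
    qed
    show "(\<Sum>i\<in>{1..p}. act (mat_abs (AGI i)) (u i) r) < act (comparison_mat (mat_sum p n AGG)) v r"
      if r: "r < n" for r
    proof -
      have "(\<Sum>i\<in>{1..p}. \<Sum>s<m i. E $$ (L + r, pos i + s) * u i s)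
          = - (\<Sum>i\<in>{1..p}. act (mat_abs (AGI i)) (u i) r)"
        unfolding sum_negf[symmetric] using r
        by (intro sum.cong refl) (simp add: E_GI act_abs[OF AGI r] sum_negf)
      moreover have "(\<Sum>s<n. E $$ (L + r, L + s) * v s) = act (comparison_mat G) v r"
        using r G by (simp add: E_GG act_def comparison_mat_def)
      ultimately show ?thesis using Ew[of "L + r"] r by (simp add: blocks G_def)
    qed
  qed
qed

section \<open>Contraction of the iteration matrices\<close>

lemma mat_inv_inverse:
  assumes M: "M \<in> carrier_mat n n" and inv: "invertible_mat M"
  shows "mat_inv M \<in> carrier_mat n n" "M * mat_inv M = 1\<^sub>m n" "mat_inv M * M = 1\<^sub>m n"
proof -
  from inv obtain B where B: "M * B = 1\<^sub>m n" "B * M = 1\<^sub>m (dim_row B)"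
    using M by (auto simp: invertible_mat_def inverts_mat_def)
  have "dim_col B = n" using arg_cong[OF B(1), of dim_col] by simp
  moreover have "dim_row B = n" using arg_cong[OF B(2), of dim_col] M by simp
  ultimately have "M \<in> Units (ring_mat TYPE('a) n ())"
    using B M by (auto simp: Units_def ring_mat_def intro!: bexI[of _ B])
  then obtain C where "mat_inverse M = Some C"
    using mat_inverse(1)[OF M, where b = "()"] by (cases "mat_inverse M") auto
  with mat_inverse(2)[OF M this]
  show "mat_inv M \<in> carrier_mat n n" "M * mat_inv M = 1\<^sub>m n" "mat_inv M * M = 1\<^sub>m n"
    by (auto simp: mat_inv_def)
qed

text \<open>
  With \<open>Y\<^sub>i = A\<^sub>I\<^sub>I\<^sup>-\<^sup>1 A\<^sub>I\<^sub>\<Gamma>\<close> and \<open>W = M\<^sup>-\<^sup>1\<close>, the iteration matrix of subdomain \<open>i\<close> is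
  \<open>(J\<^sub>i - W A\<^sub>\<Gamma>\<^sub>\<Gamma>) + W A\<^sub>\<Gamma>\<^sub>I Y\<^sub>i\<close>. The condition on the absolute values lets the first parts be summed without
  loss, to \<open>|W (M - A\<^sub>\<Gamma>\<^sub>\<Gamma>)|\<close>; the interior rows give \<open>|Y\<^sub>i| v \<le> u\<^sub>i\<close> for the second parts. The whole sum
  is thus at most \<open>|W| g\<close> with \<open>g = |M - A\<^sub>\<Gamma>\<^sub>\<Gamma>| v + \<Sum>\<^sub>i |A\<^sub>\<Gamma>\<^sub>I| u\<^sub>i\<close>. The splitting condition turns the
  interface rows into \<open>g < \<langle>M\<rangle> v\<close>, which is exactly what \<open>|W| g < v\<close> requires.
\<close>

lemma schur_iteration_contraction:
  assumes AII: "\<And>i. i \<in> {1..p} \<Longrightarrow> AII i \<in> carrier_mat (m i) (m i)"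
    and AII_inv: "\<And>i. i \<in> {1..p} \<Longrightarrow> invertible_mat (AII i)"
    and AIG: "\<And>i. i \<in> {1..p} \<Longrightarrow> AIG i \<in> carrier_mat (m i) n"
    and AGI: "\<And>i. i \<in> {1..p} \<Longrightarrow> AGI i \<in> carrier_mat n (m i)"
    and AGG: "\<And>i. i \<in> {1..p} \<Longrightarrow> AGG i \<in> carrier_mat n n"
    and M: "M \<in> carrier_mat n n" and M_inv: "invertible_mat M"
    and J: "\<And>i. i \<in> {1..p} \<Longrightarrow> J i \<in> carrier_mat n n"
    and J_sum: "mat_sum p n J = 1\<^sub>m n"
    and abs_sum: "mat_sum p n (\<lambda>i. mat_abs (J i - mat_inv M * AGG i)) =
                  mat_abs (mat_sum p n (\<lambda>i. J i - mat_inv M * AGG i))"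
    and M_split: "comparison_mat M - mat_abs (M - mat_sum p n AGG) =
                  comparison_mat (mat_sum p n AGG)"
    and u: "\<And>i r. i \<in> {1..p} \<Longrightarrow> r < m i \<Longrightarrow> 0 < u i r"
    and v: "\<And>r. r < n \<Longrightarrow> 0 < v r"
    and interior: "\<And>i r. i \<in> {1..p} \<Longrightarrow> r < m i \<Longrightarrow>
      act (mat_abs (AIG i)) v r < act (comparison_mat (AII i)) (u i) r"
    and interface: "\<And>r. r < n \<Longrightarrow>
      (\<Sum>i\<in>{1..p}. act (mat_abs (AGI i)) (u i) r) < act (comparison_mat (mat_sum p n AGG)) v r"
    and r: "r < n"
  shows "(\<Sum>i\<in>{1..p}. act (mat_abs (J i - mat_inv M * schur_mat (AII i) (AIG i) (AGI i) (AGG i))) v r)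
    < v r"
proof -
  define W where "W = mat_inv M"
  define G where "G = mat_sum p n AGG"
  define Y where "Y i = mat_inv (AII i) * AIG i" for i
  have W: "W \<in> carrier_mat n n" "M * W = 1\<^sub>m n" "W * M = 1\<^sub>m n"
    using mat_inv_inverse[OF M M_inv] by (auto simp: W_def)
  have G: "G \<in> carrier_mat n n" by (simp add: G_def mat_sum_def)
  have MG: "M - G \<in> carrier_mat n n" using G by (rule minus_carrier_mat)
  define g where "g s = act (mat_abs (M - G)) v s + (\<Sum>i\<in>{1..p}. act (mat_abs (AGI i)) (u i) s)" for s
  have g_nonneg: "0 \<le> g s" if "s < n" for s
    unfolding g_def using that u v
    by (intro add_nonneg_nonneg sum_nonneg act_abs_nonneg[OF MG] act_abs_nonneg[OF AGI])
      (auto intro: less_imp_le)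
  have g_less: "g s < act (comparison_mat M) v s" if s: "s < n" for s
  proof -
    have "act (comparison_mat G) v s = act (comparison_mat M) v s - act (mat_abs (M - G)) v s"
      unfolding G_def M_split[symmetric] using M s
      by (simp add: act_def comparison_mat_def mat_abs_def mat_sum_def left_diff_distrib sum_subtractf)
    then show ?thesis using interface[OF s] by (simp add: g_def G_def)
  qed
  have Wg: "act (mat_abs W) g r < v r"
  proof (rule comparison_solution_bound[OF M W(1,2), where v = v and z = g])
    fix s assume s: "s < n"
    have "act (mat_abs (1\<^sub>m n :: 'a mat)) g s = (\<Sum>t<n. if t = s then g s else 0)"
      unfolding act_abs[OF one_carrier_mat s] using s by (intro sum.cong) auto
    then show "act (mat_abs (1\<^sub>m n :: 'a mat)) g s < act (comparison_mat M) v s"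
      using g_less[OF s] s by simp
  qed (use v g_nonneg r in auto)
  have Y: "Y i \<in> carrier_mat (m i) n" if "i \<in> {1..p}" for i
    unfolding Y_def using mat_inv_inverse(1)[OF AII[OF that] AII_inv[OF that]] AIG[OF that] by auto
  have Yv: "act (mat_abs (Y i)) v s \<le> u i s" if i: "i \<in> {1..p}" and s: "s < m i" for i s
  proof -
    note inv = mat_inv_inverse[OF AII[OF i] AII_inv[OF i]]
    have "AII i * Y i = AII i * mat_inv (AII i) * AIG i"
      unfolding Y_def by (rule assoc_mult_mat[symmetric, OF AII[OF i] inv(1) AIG[OF i]])
    then have AY: "AII i * Y i = AIG i" using inv(2) AIG[OF i] by simp
    have "act (mat_abs (Y i)) v s < u i s"
      using v by (intro comparison_solution_bound[OF AII[OF i] Y[OF i] AY, where z = v and v = "u i"])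
        (auto intro: less_imp_le u[OF i] interior[OF i] s)
    then show ?thesis by simp
  qed
  have bound: "act (mat_abs (J i - W * schur_mat (AII i) (AIG i) (AGI i) (AGG i))) v r
      \<le> act (mat_abs (J i - W * AGG i)) v r + act (mat_abs W) (act (mat_abs (AGI i)) (u i)) r"
    if i: "i \<in> {1..p}" for i
  proof -
    have WG: "W * AGG i \<in> carrier_mat n n" using W AGG[OF i] by auto
    have GY: "AGI i * Y i \<in> carrier_mat n n" using AGI[OF i] Y[OF i] by auto
    have "schur_mat (AII i) (AIG i) (AGI i) (AGG i) = AGG i - AGI i * Y i"
      unfolding schur_mat_def Y_def
      by (subst assoc_mult_mat[OF AGI[OF i] mat_inv_inverse(1)[OF AII[OF i] AII_inv[OF i]] AIG[OF i]]) simp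
    moreover have "W * (AGG i - AGI i * Y i) = W * AGG i - W * (AGI i * Y i)"
      using W(1) AGG[OF i] GY by (rule mult_minus_distrib_mat)
    moreover have "P - (Q - Z) = (P - Q) + Z"
      if "P \<in> carrier_mat n n" "Q \<in> carrier_mat n n" "Z \<in> carrier_mat n n" for P Q Z :: "'a mat"
      using that by (intro eq_matI) auto
    ultimately have T: "J i - W * schur_mat (AII i) (AIG i) (AGI i) (AGG i)
        = (J i - W * AGG i) + W * (AGI i * Y i)"
      using J[OF i] WG mult_carrier_mat[OF W(1) GY] by (simp only:)
    have "act (mat_abs (J i - W * schur_mat (AII i) (AIG i) (AGI i) (AGG i))) v r
        \<le> act (mat_abs (J i - W * AGG i)) v r + act (mat_abs (W * (AGI i * Y i))) v r"
      unfolding T using v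
      by (intro act_abs_add_le[OF minus_carrier_mat[OF WG] mult_carrier_mat[OF W(1) GY] r])
        (rule less_imp_le)
    also have "act (mat_abs (W * (AGI i * Y i))) v r \<le> act (mat_abs W) (act (mat_abs (AGI i * Y i)) v) r"
      using v by (intro act_abs_mult_le[OF W(1) GY r]) (auto intro: less_imp_le)
    also have "\<dots> \<le> act (mat_abs W) (act (mat_abs (AGI i)) (u i)) r"
    proof (rule act_abs_mono[OF W(1) r])
      fix s assume s: "s < n"
      have "act (mat_abs (AGI i * Y i)) v s \<le> act (mat_abs (AGI i)) (act (mat_abs (Y i)) v) s"
        using v by (intro act_abs_mult_le[OF AGI[OF i] Y[OF i] s]) (auto intro: less_imp_le)
      also have "\<dots> \<le> act (mat_abs (AGI i)) (u i) s"
        using Yv[OF i] by (intro act_abs_mono[OF AGI[OF i] s])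
      finally show "act (mat_abs (AGI i * Y i)) v s \<le> act (mat_abs (AGI i)) (u i) s" .
    qed
    finally show ?thesis by simp
  qed
  have total: "mat_sum p n (\<lambda>i. J i - W * AGG i) = W * (M - G)"
  proof -
    have "mat_sum p n (\<lambda>i. J i - W * AGG i) = mat_sum p n J - W * G"
    proof (rule eq_matI)
      fix a b assume "a < dim_row (mat_sum p n J - W * G)" "b < dim_col (mat_sum p n J - W * G)"
      then have ab: "a < n" "b < n" using G W by auto
      have "(W * G) $$ (a, b) = (\<Sum>c<n. \<Sum>i\<in>{1..p}. W $$ (a, c) * AGG i $$ (c, b))"
        using W(1) ab by (auto simp: G_def mat_sum_def scalar_prod_def sum_distrib_left atLeast0LessThan)
      also have "\<dots> = (\<Sum>i\<in>{1..p}. \<Sum>c<n. W $$ (a, c) * AGG i $$ (c, b))" by (rule sum.swap)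
      also have "\<dots> = (\<Sum>i\<in>{1..p}. (W * AGG i) $$ (a, b))"
        using W(1) ab carrier_matD[OF AGG]
        by (intro sum.cong) (auto simp: scalar_prod_def atLeast0LessThan)
      finally have WG: "(W * G) $$ (a, b) = (\<Sum>i\<in>{1..p}. (W * AGG i) $$ (a, b))" .
      have "(\<Sum>i\<in>{1..p}. (J i - W * AGG i) $$ (a, b)) = (\<Sum>i\<in>{1..p}. J i $$ (a, b) - (W * AGG i) $$ (a, b))"
        using W(1) ab carrier_matD[OF AGG] by (intro sum.cong) auto
      then show "mat_sum p n (\<lambda>i. J i - W * AGG i) $$ (a, b) = (mat_sum p n J - W * G) $$ (a, b)"
        using ab W(1) G by (simp add: mat_sum_def WG sum_subtractf del: index_mult_mat(1))
    qed (use G W in \<open>auto simp: mat_sum_def\<close>)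
    also have "\<dots> = W * (M - G)" unfolding J_sum W(3)[symmetric]
      by (rule mult_minus_distrib_mat[symmetric, OF W(1) M G])
    finally show ?thesis .
  qed
  have "(\<Sum>i\<in>{1..p}. act (mat_abs (J i - W * AGG i)) v r)
      = (\<Sum>i\<in>{1..p}. \<Sum>s<n. norm ((J i - W * AGG i) $$ (r, s)) * v s)"
    using r W(1) AGG by (intro sum.cong act_abs[of _ n n] refl) (auto intro!: minus_carrier_mat)
  also have "\<dots> = (\<Sum>s<n. \<Sum>i\<in>{1..p}. norm ((J i - W * AGG i) $$ (r, s)) * v s)"
    by (rule sum.swap)
  also have "\<dots> = act (mat_sum p n (\<lambda>i. mat_abs (J i - W * AGG i))) v r"
  proof -
    have "(J i - W * AGG i) \<in> carrier_mat n n" if "i \<in> {1..p}" for i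
      using W(1) AGG[OF that] by (intro minus_carrier_mat) auto
    from carrier_matD[OF this] show ?thesis
      using r by (auto simp: act_def mat_sum_def mat_abs_def sum_distrib_right intro!: sum.cong)
  qed
  also have "\<dots> = act (mat_abs (W * (M - G))) v r"
    using abs_sum total by (simp add: W_def)
  also have "\<dots> \<le> act (mat_abs W) (act (mat_abs (M - G)) v) r"
    using v by (intro act_abs_mult_le[OF W(1) MG r]) (auto intro: less_imp_le)
  finally have first: "(\<Sum>i\<in>{1..p}. act (mat_abs (J i - W * AGG i)) v r)
      \<le> act (mat_abs W) (act (mat_abs (M - G)) v) r" .
  have "(\<Sum>i\<in>{1..p}. act (mat_abs (J i - W * schur_mat (AII i) (AIG i) (AGI i) (AGG i))) v r)
      \<le> (\<Sum>i\<in>{1..p}. act (mat_abs (J i - W * AGG i)) v r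
          + act (mat_abs W) (act (mat_abs (AGI i)) (u i)) r)"
    by (rule sum_mono) (rule bound)
  also have "\<dots> \<le> act (mat_abs W) (act (mat_abs (M - G)) v) r
        + (\<Sum>i\<in>{1..p}. act (mat_abs W) (act (mat_abs (AGI i)) (u i)) r)"
    unfolding sum.distrib using first by (rule add_right_mono)
  also have "\<dots> = act (mat_abs W) g r"
    using sum.swap[of "\<lambda>i s. norm (W $$ (r, s)) * act (mat_abs (AGI i)) (u i) s" "{..<n}" "{1..p}"]
    by (simp add: act_abs[OF W(1) r] g_def distrib_left sum.distrib sum_distrib_left)
  also note Wg
  finally show ?thesis by (simp add: W_def)
qed

section \<open>Fixed points and solvability of the interface problem\<close>

lemma norm_sum_mult_vec_le:
  assumes T: "\<And>j. j \<in> {1..p} \<Longrightarrow> T j \<in> carrier_mat n n"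
    and y: "\<And>j. j \<in> {1..p} \<Longrightarrow> y j \<in> carrier_vec n"
    and bound: "\<And>j s. j \<in> {1..p} \<Longrightarrow> s < n \<Longrightarrow> norm (y j $ s) \<le> b * v s"
    and r: "r < n"
  shows "norm (\<Sum>j\<in>{1..p}. (T j *\<^sub>v y j) $ r) \<le> b * (\<Sum>j\<in>{1..p}. act (mat_abs (T j)) v r)"
  unfolding sum_distrib_left
proof (rule sum_norm_le)
  fix j assume j: "j \<in> {1..p}"
  have "norm ((T j *\<^sub>v y j) $ r) = norm (\<Sum>s<n. T j $$ (r, s) * y j $ s)"
    using T[OF j] y[OF j] r by (auto simp: scalar_prod_def atLeast0LessThan)
  also have "\<dots> \<le> (\<Sum>s<n. norm (T j $$ (r, s)) * (b * v s))"
    using bound[OF j] by (intro sum_norm_le) (auto simp: norm_mult intro: mult_left_mono)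
  also have "\<dots> = b * act (mat_abs (T j)) v r"
    by (simp add: act_abs[OF T[OF j] r] sum_distrib_left mult.left_commute)
  finally show "norm ((T j *\<^sub>v y j) $ r) \<le> b * act (mat_abs (T j)) v r" .
qed

text \<open>
  Where \<open>|z| / v\<close> is maximal, with value \<open>t > 0\<close>, the contraction would give \<open>|z| < t v\<close>.
\<close>

lemma vec_zero_if_contracted:
  assumes T: "\<And>j. j \<in> {1..p} \<Longrightarrow> T j \<in> carrier_mat n n"
    and v: "\<And>r. r < n \<Longrightarrow> 0 < v r"
    and contr: "\<And>r. r < n \<Longrightarrow> (\<Sum>j\<in>{1..p}. act (mat_abs (T j)) v r) < v r"
    and z: "z \<in> carrier_vec n"
    and fix_z: "\<And>r. r < n \<Longrightarrow> (\<Sum>j\<in>{1..p}. (T j *\<^sub>v z) $ r) = z $ r"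
  shows "z = 0\<^sub>v n"
proof (rule ccontr)
  assume "z \<noteq> 0\<^sub>v n"
  then obtain a where a: "a < n" "z $ a \<noteq> 0" using z by (metis carrier_vecD eq_vecI index_zero_vec)
  define t where "t = Max ((\<lambda>s. norm (z $ s) / v s) ` {..<n})"
  have ratio: "norm (z $ s) / v s \<le> t" if "s < n" for s using that by (auto simp: t_def)
  have le: "norm (z $ s) \<le> t * v s" if "s < n" for s
    using ratio[OF that] v[OF that] by (simp add: pos_divide_le_eq)
  have "0 < norm (z $ a) / v a" using a v by simp
  with ratio[OF a(1)] have t: "0 < t" by linarith
  have "t \<in> (\<lambda>s. norm (z $ s) / v s) ` {..<n}" unfolding t_def using a by (intro Max_in) auto
  then obtain h where h: "h < n" "t = norm (z $ h) / v h" by auto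
  have "norm (z $ h) \<le> t * (\<Sum>j\<in>{1..p}. act (mat_abs (T j)) v h)"
    unfolding fix_z[OF h(1), symmetric] using T z le h(1) by (intro norm_sum_mult_vec_le) auto
  also have "\<dots> < t * v h" using contr[OF h(1)] t by simp
  also have "\<dots> = norm (z $ h)" using h v[of h] by simp
  finally show False by simp
qed

lemma schur_local_update_affine:
  assumes "M \<in> carrier_mat n n" "invertible_mat M"
    and "J j \<in> carrier_mat n n" "S j \<in> carrier_mat n n" "d j \<in> carrier_vec n" "z \<in> carrier_vec n"
  shows "schur_local_update M J S d j z = (J j - mat_inv M * S j) *\<^sub>v z + mat_inv M *\<^sub>v d j"
proof -
  have W: "mat_inv M \<in> carrier_mat n n" using assms(1,2) by (rule mat_inv_inverse)
  have Sz: "S j *\<^sub>v z \<in> carrier_vec n" using assms by auto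
  have "mat_inv M *\<^sub>v (d j - S j *\<^sub>v z) = mat_inv M *\<^sub>v d j - mat_inv M *\<^sub>v (S j *\<^sub>v z)"
    using W assms(5) Sz by (rule mult_minus_distrib_mat_vec)
  also have "mat_inv M *\<^sub>v (S j *\<^sub>v z) = (mat_inv M * S j) *\<^sub>v z"
    using W assms by (intro assoc_mult_mat_vec[symmetric])
  finally have 1: "mat_inv M *\<^sub>v (d j - S j *\<^sub>v z) = mat_inv M *\<^sub>v d j - (mat_inv M * S j) *\<^sub>v z" .
  have WS: "mat_inv M * S j \<in> carrier_mat n n" using W assms by auto
  have 2: "(J j - mat_inv M * S j) *\<^sub>v z = J j *\<^sub>v z - (mat_inv M * S j) *\<^sub>v z"
    using assms(3) WS assms(6) by (rule minus_mult_distrib_mat_vec)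
  show ?thesis
    unfolding schur_local_update_def 1 2 using W WS assms by (intro eq_vecI) auto
qed

lemma mat_sum_mult_vec:
  assumes F: "\<And>i. i \<in> {1..p} \<Longrightarrow> F i \<in> carrier_mat n n" and z: "z \<in> carrier_vec n" and r: "r < n"
  shows "(mat_sum p n F *\<^sub>v z) $ r = (\<Sum>i\<in>{1..p}. (F i *\<^sub>v z) $ r)"
proof -
  have "(mat_sum p n F *\<^sub>v z) $ r = (\<Sum>s<n. \<Sum>i\<in>{1..p}. F i $$ (r, s) * z $ s)"
    using z r by (simp add: mat_sum_def scalar_prod_def sum_distrib_right atLeast0LessThan)
  also have "\<dots> = (\<Sum>i\<in>{1..p}. \<Sum>s<n. F i $$ (r, s) * z $ s)" by (rule sum.swap)
  also have "\<dots> = (\<Sum>i\<in>{1..p}. (F i *\<^sub>v z) $ r)"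
    using z r carrier_matD[OF F] by (intro sum.cong) (auto simp: scalar_prod_def atLeast0LessThan)
  finally show ?thesis .
qed

lemma mult_vec_vec_sum:
  assumes W: "W \<in> carrier_mat n n" and f: "\<And>i. i \<in> {1..p} \<Longrightarrow> f i \<in> carrier_vec n" and r: "r < n"
  shows "(W *\<^sub>v vec_sum p n f) $ r = (\<Sum>i\<in>{1..p}. (W *\<^sub>v f i) $ r)"
proof -
  have "(W *\<^sub>v vec_sum p n f) $ r = (\<Sum>s<n. \<Sum>i\<in>{1..p}. W $$ (r, s) * f i $ s)"
    using W r by (auto simp: vec_sum_def scalar_prod_def sum_distrib_left atLeast0LessThan)
  also have "\<dots> = (\<Sum>i\<in>{1..p}. \<Sum>s<n. W $$ (r, s) * f i $ s)" by (rule sum.swap)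
  also have "\<dots> = (\<Sum>i\<in>{1..p}. (W *\<^sub>v f i) $ r)"
    using W r carrier_vecD[OF f] by (intro sum.cong) (auto simp: scalar_prod_def atLeast0LessThan)
  finally show ?thesis .
qed

text \<open>
  Summing the local updates turns \<open>\<Sum> J\<^sub>j\<close> into the identity and the residuals into the residual of the
  interface problem, which vanishes.
\<close>

lemma schur_solution_fixed_point:
  assumes M: "M \<in> carrier_mat n n" "invertible_mat M"
    and J: "\<And>j. j \<in> {1..p} \<Longrightarrow> J j \<in> carrier_mat n n"
    and J_sum: "mat_sum p n J = 1\<^sub>m n"
    and S: "\<And>j. j \<in> {1..p} \<Longrightarrow> S j \<in> carrier_mat n n"
    and d: "\<And>j. j \<in> {1..p} \<Longrightarrow> d j \<in> carrier_vec n"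
    and z: "z \<in> carrier_vec n" and sol: "mat_sum p n S *\<^sub>v z = vec_sum p n d"
    and r: "r < n"
  shows "(\<Sum>j\<in>{1..p}. schur_local_update M J S d j z $ r) = z $ r"
proof -
  define W where "W = mat_inv M"
  have W: "W \<in> carrier_mat n n" unfolding W_def using M by (rule mat_inv_inverse)
  have Sz: "S j *\<^sub>v z \<in> carrier_vec n" if "j \<in> {1..p}" for j using S[OF that] z by auto
  have "schur_local_update M J S d j z $ r = (J j *\<^sub>v z) $ r + ((W *\<^sub>v d j) $ r - (W *\<^sub>v (S j *\<^sub>v z)) $ r)"
    if j: "j \<in> {1..p}" for j
  proof -
    have "W *\<^sub>v (d j - S j *\<^sub>v z) = W *\<^sub>v d j - W *\<^sub>v (S j *\<^sub>v z)"
      using W d[OF j] Sz[OF j] by (rule mult_minus_distrib_mat_vec)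
    then show ?thesis
      using W J[OF j] r unfolding schur_local_update_def W_def[symmetric] by auto
  qed
  then have "(\<Sum>j\<in>{1..p}. schur_local_update M J S d j z $ r) =
      (mat_sum p n J *\<^sub>v z) $ r + ((W *\<^sub>v vec_sum p n d) $ r - (W *\<^sub>v vec_sum p n (\<lambda>j. S j *\<^sub>v z)) $ r)"
    using mat_sum_mult_vec[OF J z r] mult_vec_vec_sum[OF W d r] mult_vec_vec_sum[OF W Sz r]
    by (simp add: sum.distrib sum_subtractf)
  also have "vec_sum p n (\<lambda>j. S j *\<^sub>v z) = vec_sum p n d"
    unfolding sol[symmetric] using mat_sum_mult_vec[OF S z]
    by (intro eq_vecI) (auto simp: vec_sum_def mat_sum_def simp del: index_mult_mat_vec)
  finally show ?thesis using z by (simp add: J_sum)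
qed

text \<open>
  A vector in the kernel of the summed matrix is a fixed point of the iteration with right-hand side
  zero, hence zero by contraction. So the matrix has nonzero determinant.
\<close>

lemma schur_system_uniquely_solvable:
  assumes M: "M \<in> carrier_mat n n" "invertible_mat M"
    and J: "\<And>j. j \<in> {1..p} \<Longrightarrow> J j \<in> carrier_mat n n"
    and J_sum: "mat_sum p n J = 1\<^sub>m n"
    and S: "\<And>j. j \<in> {1..p} \<Longrightarrow> S j \<in> carrier_mat n n"
    and v: "\<And>r. r < n \<Longrightarrow> 0 < v r"
    and contr: "\<And>r. r < n \<Longrightarrow> (\<Sum>j\<in>{1..p}. act (mat_abs (J j - mat_inv M * S j)) v r) < v r"
    and b: "b \<in> carrier_vec n"
  shows "\<exists>!z. z \<in> carrier_vec n \<and> mat_sum p n S *\<^sub>v z = b"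
proof -
  define A where "A = mat_sum p n S"
  have A: "A \<in> carrier_mat n n" by (simp add: A_def mat_sum_def)
  have W: "mat_inv M \<in> carrier_mat n n" using M by (rule mat_inv_inverse)
  define T where "T j = J j - mat_inv M * S j" for j
  have T: "T j \<in> carrier_mat n n" if "j \<in> {1..p}" for j
    unfolding T_def using W S[OF that] by (intro minus_carrier_mat) auto
  have kernel: "z = 0\<^sub>v n" if z: "z \<in> carrier_vec n" and Az: "A *\<^sub>v z = 0\<^sub>v n" for z
  proof (rule vec_zero_if_contracted[OF T v _ z])
    show "(\<Sum>j\<in>{1..p}. act (mat_abs (T j)) v r) < v r" if "r < n" for r
      using contr that by (simp add: T_def)
    show "(\<Sum>j\<in>{1..p}. (T j *\<^sub>v z) $ r) = z $ r" if r: "r < n" for r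
    proof -
      have "mat_sum p n S *\<^sub>v z = vec_sum p n (\<lambda>_. 0\<^sub>v n)"
        using Az by (auto simp: A_def vec_sum_def)
      then have "(\<Sum>j\<in>{1..p}. schur_local_update M J S (\<lambda>_. 0\<^sub>v n) j z $ r) = z $ r"
        using z r by (intro schur_solution_fixed_point[OF M J J_sum S]) auto
      moreover have "schur_local_update M J S (\<lambda>_. 0\<^sub>v n) j z $ r = (T j *\<^sub>v z) $ r"
        if j: "j \<in> {1..p}" for j
      proof -
        have "schur_local_update M J S (\<lambda>_. 0\<^sub>v n) j z = T j *\<^sub>v z + mat_inv M *\<^sub>v 0\<^sub>v n"
          unfolding T_def using J[OF j] S[OF j] z by (intro schur_local_update_affine[OF M]) auto
        then show ?thesis
          using r carrier_matD[OF W] carrier_matD[OF T[OF j]] by (simp add: scalar_prod_def)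
      qed
      ultimately show ?thesis by simp
    qed
  qed
  then have "det A \<noteq> 0" using det_0_iff_vec_prod_zero[OF A] by auto
  then have "A \<in> Units (ring_mat TYPE('a) n ())" by (rule det_non_zero_imp_unit[OF A])
  then obtain B where B: "B \<in> carrier_mat n n" "B * A = 1\<^sub>m n" "A * B = 1\<^sub>m n"
    by (auto simp: Units_def ring_mat_def)
  show ?thesis
  proof (rule ex1I[of _ "B *\<^sub>v b"])
    have "A *\<^sub>v (B *\<^sub>v b) = (A * B) *\<^sub>v b" using A B b by (intro assoc_mult_mat_vec[symmetric])
    then show "B *\<^sub>v b \<in> carrier_vec n \<and> mat_sum p n S *\<^sub>v (B *\<^sub>v b) = b"
      using B b by (auto simp: A_def)
    fix z assume z: "z \<in> carrier_vec n \<and> mat_sum p n S *\<^sub>v z = b"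
    have "(B * A) *\<^sub>v z = B *\<^sub>v (A *\<^sub>v z)" using A B z by (intro assoc_mult_mat_vec) auto
    then show "z = B *\<^sub>v b" using z B by (simp add: A_def)
  qed
qed

section \<open>Asynchronous convergence\<close>

text \<open>
  The asynchronous convergence principle of Bertsekas. Suppose that all iterates lie in \<open>X N\<close> from
  step \<open>K\<close> on. The delays tend to infinity, so eventually only data from step \<open>K\<close> or later are used,
  and every update then lands in \<open>X (N + 1)\<close>. Each component is updated again after that moment and
  cannot leave \<open>X (N + 1)\<close> any more.
\<close>

lemma async_nested_sets:
  assumes sched: "async_schedule p P \<tau>"
    and start: "\<And>i. i \<in> {1..p} \<Longrightarrow> x i 0 \<in> X 0"
    and nested: "\<And>N. X (Suc N) \<subseteq> X N"
    and idle: "\<And>i k. i \<in> {1..p} \<Longrightarrow> i \<notin> P k \<Longrightarrow> x i (Suc k) = x i k"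
    and update: "\<And>i k N. i \<in> {1..p} \<Longrightarrow> i \<in> P k \<Longrightarrow> (\<And>j. j \<in> {1..p} \<Longrightarrow> x j (\<tau> i j k) \<in> X N) \<Longrightarrow>
      x i (Suc k) \<in> X (Suc N)"
  shows "\<exists>K. \<forall>k\<ge>K. \<forall>i\<in>{1..p}. x i k \<in> X N"
proof (induction N)
  case 0
  have "\<forall>i\<in>{1..p}. x i k \<in> X 0" for k
  proof (induction k rule: less_induct)
    case (less k)
    show ?case
    proof
      fix i assume i: "i \<in> {1..p}"
      show "x i k \<in> X 0"
      proof (cases k)
        case 0
        then show ?thesis using start i by simp
      next
        case (Suc l)
        show ?thesis
        proof (cases "i \<in> P l")
          case True
          have "x j (\<tau> i j l) \<in> X 0" if "j \<in> {1..p}" for j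
            using less.IH[of "\<tau> i j l"] sched i that Suc
            by (auto simp: async_schedule_def le_imp_less_Suc)
          then have "x i (Suc l) \<in> X (Suc 0)" using i True by (intro update) auto
          then show ?thesis using nested Suc by auto
        next
          case False
          then show ?thesis using less.IH[of l] idle[OF i False] i Suc by auto
        qed
      qed
    qed
  qed
  then show ?case by auto
next
  case (Suc N)
  then obtain K where K: "\<And>k i. K \<le> k \<Longrightarrow> i \<in> {1..p} \<Longrightarrow> x i k \<in> X N" by blast
  have "\<forall>\<^sub>F k in sequentially. \<forall>i\<in>{1..p}. \<forall>j\<in>{1..p}. K \<le> \<tau> i j k"
    using sched by (auto simp: async_schedule_def filterlim_at_top eventually_ball_finite)
  then obtain L where L: "\<And>k i j. L \<le> k \<Longrightarrow> i \<in> {1..p} \<Longrightarrow> j \<in> {1..p} \<Longrightarrow> K \<le> \<tau> i j k"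
    unfolding eventually_sequentially by blast
  have active: "x i (Suc k) \<in> X (Suc N)" if "i \<in> {1..p}" "i \<in> P k" "L \<le> k" for i k
    using that K L by (intro update) auto
  have "\<forall>\<^sub>F k in sequentially. x i k \<in> X (Suc N)" if i: "i \<in> {1..p}" for i
  proof -
    have "infinite {k. i \<in> P k}" using sched i by (auto simp: async_schedule_def)
    then obtain l where l: "l \<ge> L" "i \<in> P l" by (auto simp: infinite_nat_iff_unbounded_le)
    have "x i k \<in> X (Suc N)" if "Suc l \<le> k" for k
      using that
    proof (induction k rule: dec_induct)
      case base
      show ?case using i l by (intro active)
    next
      case (step k)
      then show ?case using active[OF i, of k] idle[OF i, of k] l(1) by (cases "i \<in> P k") auto
    qed
    then show ?thesis unfolding eventually_sequentially by blast
  qed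
  then have "\<forall>\<^sub>F k in sequentially. \<forall>i\<in>{1..p}. x i k \<in> X (Suc N)"
    by (intro eventually_ball_finite) auto
  then show ?case unfolding eventually_sequentially by blast
qed

text \<open>
  In the norm weighted by \<open>v\<close> the joint update is a contraction with factor
  \<open>\<theta> < 1\<close>, whatever mixture of old iterates is fed into it. The balls of radius \<open>\<theta>\<^sup>N b\<close> around the
  solution are therefore nested sets to which the asynchronous convergence principle applies.
\<close>

theorem async_schur_convergent_if_contracted:
  assumes M: "M \<in> carrier_mat n n" "invertible_mat M"
    and J: "\<And>j. j \<in> {1..p} \<Longrightarrow> J j \<in> carrier_mat n n"
    and J_sum: "mat_sum p n J = 1\<^sub>m n"
    and S: "\<And>j. j \<in> {1..p} \<Longrightarrow> S j \<in> carrier_mat n n"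
    and d: "\<And>j. j \<in> {1..p} \<Longrightarrow> d j \<in> carrier_vec n"
    and v: "\<And>r. r < n \<Longrightarrow> 0 < v r"
    and contr: "\<And>r. r < n \<Longrightarrow> (\<Sum>j\<in>{1..p}. act (mat_abs (J j - mat_inv M * S j)) v r) < v r"
  shows "async_schur_convergent p n M J S d"
proof -
  have W: "mat_inv M \<in> carrier_mat n n" using M by (rule mat_inv_inverse)
  define T where "T j = J j - mat_inv M * S j" for j
  have T: "T j \<in> carrier_mat n n" if "j \<in> {1..p}" for j
    unfolding T_def using W S[OF that] by (intro minus_carrier_mat) auto
  have d_sum: "vec_sum p n d \<in> carrier_vec n" by (simp add: vec_sum_def)
  have "\<exists>!z. z \<in> carrier_vec n \<and> mat_sum p n S *\<^sub>v z = vec_sum p n d"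
    using schur_system_uniquely_solvable[OF M J J_sum S v contr d_sum] .
  then obtain xs where xs: "xs \<in> carrier_vec n" "mat_sum p n S *\<^sub>v xs = vec_sum p n d"
    and unique: "\<And>z. z \<in> carrier_vec n \<Longrightarrow> mat_sum p n S *\<^sub>v z = vec_sum p n d \<Longrightarrow> z = xs"
    by blast
  \<comment> \<open>Inserting \<open>0\<close> makes the maximum defined for \<open>n = 0\<close> as well.\<close>
  define \<theta> where "\<theta> = Max (insert 0 ((\<lambda>r. (\<Sum>j\<in>{1..p}. act (mat_abs (T j)) v r) / v r) ` {..<n}))"
  have \<theta>_nonneg: "0 \<le> \<theta>" by (simp add: \<theta>_def)
  have \<theta>_less: "\<theta> < 1" using contr v by (auto simp: \<theta>_def T_def)
  have \<theta>: "(\<Sum>j\<in>{1..p}. act (mat_abs (T j)) v r) \<le> \<theta> * v r" if r: "r < n" for r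
  proof -
    have "(\<Sum>j\<in>{1..p}. act (mat_abs (T j)) v r) / v r \<le> \<theta>" unfolding \<theta>_def using r by auto
    then show ?thesis using v[OF r] by (simp add: pos_divide_le_eq)
  qed
  have "\<forall>i\<in>{1..p}. \<forall>r<n. (\<lambda>k. x i k $ r) \<longlonglongrightarrow> xs $ r"
    if sched: "async_schedule p P \<tau>" and iter: "async_schur_iterates p n M J S d P \<tau> x" for P \<tau> x
  proof -
    \<comment> \<open>The sum is a crude bound for the weighted initial errors of all subdomains.\<close>
    define b where "b = (\<Sum>i\<in>{1..p}. \<Sum>r<n. norm (x i 0 $ r - xs $ r) / v r)"
    have b: "norm (x i 0 $ r - xs $ r) \<le> b * v r" if i: "i \<in> {1..p}" and r: "r < n" for i r
    proof -
      have "norm (x i 0 $ r - xs $ r) / v r \<le> (\<Sum>r<n. norm (x i 0 $ r - xs $ r) / v r)"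
        using r v by (intro member_le_sum) (auto intro: divide_nonneg_pos)
      also have "\<dots> \<le> b"
        unfolding b_def using i v by (intro member_le_sum) (auto intro!: sum_nonneg divide_nonneg_pos)
      finally show ?thesis using v[OF r] by (simp add: pos_divide_le_eq)
    qed
    have b_nonneg: "0 \<le> b"
      unfolding b_def using v by (auto intro!: sum_nonneg divide_nonneg_pos)
    define X where "X N = {z \<in> carrier_vec n. \<forall>r<n. norm (z $ r - xs $ r) \<le> \<theta> ^ N * b * v r}" for N
    have in_X: "\<exists>K. \<forall>k\<ge>K. \<forall>i\<in>{1..p}. x i k \<in> X N" for N
    proof (rule async_nested_sets[OF sched])
      show "x i 0 \<in> X 0" if "i \<in> {1..p}" for i
        using iter b that by (auto simp: X_def async_schur_iterates_def)
      show "X (Suc N) \<subseteq> X N" for N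
      proof
        fix z assume z: "z \<in> X (Suc N)"
        have "\<theta> ^ Suc N * b * v r \<le> \<theta> ^ N * b * v r" if "r < n" for r
          using \<theta>_nonneg \<theta>_less b_nonneg v[OF that]
          by (intro mult_right_mono power_decreasing) auto
        then show "z \<in> X N" using z by (force simp: X_def)
      qed
      show "x i (Suc k) = x i k" if "i \<in> {1..p}" "i \<notin> P k" for i k
        using iter that by (simp add: async_schur_iterates_def)
      show "x i (Suc k) \<in> X (Suc N)"
        if i: "i \<in> {1..p}" "i \<in> P k" and prev: "\<And>j. j \<in> {1..p} \<Longrightarrow> x j (\<tau> i j k) \<in> X N" for i k N
      proof -
        define y where "y j = x j (\<tau> i j k)" for j
        have y: "y j \<in> carrier_vec n" "\<And>r. r < n \<Longrightarrow> norm (y j $ r - xs $ r) \<le> \<theta> ^ N * b * v r"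
          if "j \<in> {1..p}" for j
          using prev[OF that] by (auto simp: X_def y_def)
        have step: "x i (Suc k) = vec_sum p n (\<lambda>j. schur_local_update M J S d j (y j))"
          using iter i by (simp add: async_schur_iterates_def y_def)
        have "norm (x i (Suc k) $ r - xs $ r) \<le> \<theta> ^ Suc N * b * v r" if r: "r < n" for r
        proof -
          have diff: "schur_local_update M J S d j (y j) $ r - schur_local_update M J S d j xs $ r
              = (T j *\<^sub>v (y j - xs)) $ r" if j: "j \<in> {1..p}" for j
          proof -
            have "T j *\<^sub>v (y j - xs) = T j *\<^sub>v y j - T j *\<^sub>v xs"
              using T[OF j] y(1)[OF j] xs(1) by (rule mult_minus_distrib_mat_vec)
            moreover have "schur_local_update M J S d j z = T j *\<^sub>v z + mat_inv M *\<^sub>v d j"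
              if "z \<in> carrier_vec n" for z
              unfolding T_def using J[OF j] S[OF j] d[OF j] that
              by (intro schur_local_update_affine[OF M])
            ultimately show ?thesis
              using y(1)[OF j] xs(1) carrier_matD[OF T[OF j]] carrier_matD[OF W] r
              by (simp del: index_mult_mat_vec)
          qed
          have "x i (Suc k) $ r - xs $ r = (\<Sum>j\<in>{1..p}. (T j *\<^sub>v (y j - xs)) $ r)"
            using schur_solution_fixed_point[OF M J J_sum S d xs r] r
            by (simp add: step vec_sum_def diff[symmetric] sum_subtractf)
          also have "norm \<dots> \<le> \<theta> ^ N * b * (\<Sum>j\<in>{1..p}. act (mat_abs (T j)) v r)"
            using y xs(1) by (intro norm_sum_mult_vec_le[OF T _ _ r]) (auto intro: minus_carrier_vec)
          also have "\<dots> \<le> \<theta> ^ N * b * (\<theta> * v r)"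
            using \<theta>[OF r] \<theta>_nonneg b_nonneg by (intro mult_left_mono) auto
          finally show ?thesis by (simp add: ac_simps)
        qed
        moreover have "x i (Suc k) \<in> carrier_vec n" by (simp add: step vec_sum_def)
        ultimately show ?thesis by (auto simp: X_def)
      qed
    qed
    show ?thesis
    proof (intro ballI allI impI)
      fix i r assume i: "i \<in> {1..p}" and r: "r < n"
      show "(\<lambda>k. x i k $ r) \<longlonglongrightarrow> xs $ r"
      proof (rule metric_LIMSEQ_I)
        fix e :: real assume e: "0 < e"
        have "(\<lambda>N. \<theta> ^ N * (b * v r)) \<longlonglongrightarrow> 0 * (b * v r)"
          using \<theta>_nonneg \<theta>_less by (intro tendsto_mult tendsto_const LIMSEQ_power_zero) auto
        then have "\<forall>\<^sub>F N in sequentially. \<theta> ^ N * (b * v r) < e"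
          using e by (intro order_tendstoD(2)[where y = 0]) auto
        then obtain N where N: "\<theta> ^ N * (b * v r) < e" by (auto simp: eventually_sequentially)
        obtain K where "\<And>k. K \<le> k \<Longrightarrow> x i k \<in> X N" using in_X[of N] i by blast
        then have "dist (x i k $ r) (xs $ r) < e" if "K \<le> k" for k
          using that N r by (force simp: X_def dist_norm mult.assoc)
        then show "\<exists>K. \<forall>k\<ge>K. dist (x i k $ r) (xs $ r) < e" by blast
      qed
    qed
  qed
  then show ?thesis unfolding async_schur_convergent_def using xs unique by blast
qed

section \<open>Convergence of the primal Schur method\<close>

theorem corollary4:
  fixes p n :: nat and m :: "nat \<Rightarrow> nat"
    and AII AIG AGI AGG J :: "nat \<Rightarrow> 'a :: real_normed_field mat"
    and bI bG :: "nat \<Rightarrow> 'a vec"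
    and M :: "'a mat"
  assumes AII: "\<And>i. i \<in> {1..p} \<Longrightarrow> AII i \<in> carrier_mat (m i) (m i)"
    and AII_nonsing: "\<And>i. i \<in> {1..p} \<Longrightarrow> invertible_mat (AII i)"
    and AIG: "\<And>i. i \<in> {1..p} \<Longrightarrow> AIG i \<in> carrier_mat (m i) n"
    and AGI: "\<And>i. i \<in> {1..p} \<Longrightarrow> AGI i \<in> carrier_mat n (m i)"
    and AGG: "\<And>i. i \<in> {1..p} \<Longrightarrow> AGG i \<in> carrier_mat n n"
    and bI: "\<And>i. i \<in> {1..p} \<Longrightarrow> bI i \<in> carrier_vec (m i)"
    and bG: "\<And>i. i \<in> {1..p} \<Longrightarrow> bG i \<in> carrier_vec n"
    and M: "M \<in> carrier_mat n n"
    and M_nonsing: "invertible_mat M"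
    and J: "\<And>i. i \<in> {1..p} \<Longrightarrow> J i \<in> carrier_mat n n"
    and J_sum: "mat_sum p n J = 1\<^sub>m n"
    and abs_sum: "mat_sum p n (\<lambda>i. mat_abs (J i - mat_inv M * AGG i)) =
                  mat_abs (mat_sum p n (\<lambda>i. J i - mat_inv M * AGG i))"
    and A_H: "H_matrix (schur_block_mat p n AII AIG AGI AGG)"
    and M_split: "comparison_mat M - mat_abs (M - mat_sum p n AGG) =
                  comparison_mat (mat_sum p n AGG)"
  shows "async_schur_convergent p n M J
           (\<lambda>i. schur_mat (AII i) (AIG i) (AGI i) (AGG i))
           (\<lambda>i. schur_rhs (AII i) (AGI i) (bI i) (bG i))"
proof -
  obtain u v where u: "\<And>i r. i \<in> {1..p} \<Longrightarrow> r < m i \<Longrightarrow> 0 < u i r"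
    and v: "\<And>r. r < n \<Longrightarrow> 0 < v r"
    and interior: "\<And>i r. i \<in> {1..p} \<Longrightarrow> r < m i \<Longrightarrow>
      act (mat_abs (AIG i)) v r < act (comparison_mat (AII i)) (u i) r"
    and interface: "\<And>r. r < n \<Longrightarrow>
      (\<Sum>i\<in>{1..p}. act (mat_abs (AGI i)) (u i) r) < act (comparison_mat (mat_sum p n AGG)) v r"
    using schur_block_mat_weights[OF AII AIG AGI A_H] by blast
  have inv: "mat_inv (AII i) \<in> carrier_mat (m i) (m i)" if "i \<in> {1..p}" for i
    using mat_inv_inverse(1)[OF AII[OF that] AII_nonsing[OF that]] .
  show ?thesis
  proof (rule async_schur_convergent_if_contracted[OF M M_nonsing J J_sum _ _ v])
    fix i assume i: "i \<in> {1..p}"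
    show "schur_mat (AII i) (AIG i) (AGI i) (AGG i) \<in> carrier_mat n n"
      unfolding schur_mat_def using AGI[OF i] inv[OF i] AIG[OF i] by (intro minus_carrier_mat) auto
    show "schur_rhs (AII i) (AGI i) (bI i) (bG i) \<in> carrier_vec n"
      unfolding schur_rhs_def using AGI[OF i] inv[OF i] bI[OF i] bG[OF i] by auto
  next
    show "(\<Sum>j\<in>{1..p}. act (mat_abs (J j - mat_inv M * schur_mat (AII j) (AIG j) (AGI j) (AGG j))) v r) < v r"
      if "r < n" for r
      using schur_iteration_contraction[OF AII AII_nonsing AIG AGI AGG M M_nonsing J J_sum abs_sum
          M_split u v interior interface that] .
  qed
qed

end
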